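(* Let $m\ge1$ and let $\phi_m:\mathcal{L}^{(0,m)}+\sum_{i=1}^3\mathbb{C}z_i\to\mathbb{C}$ be a Lie algebra homomorphism with $\phi_m(z_3)=0$. Then the universal Whittaker module $\widetilde W_{\phi_m}$ is simple if and only if $\phi_m(I_m)\ne0$.
   Context: $\mathcal{L}$ has basis $\{d_n,I_n,z_1,z_2,z_3\mid n\in\mathbb{Z}\}$ with brackets $[d_n,d_m]=(m-n)d_{m+n}+\delta_{n,-m}\frac{n^3-n}{12}z_1$, $[d_n,I_m]=mI_{m+n}+\delta_{n,-m}(n^2+n)z_2$, $[I_n,I_m]=n\delta_{n,-m}z_3$, $z_i$ central. $\mathcal{L}^{(0,m)}=\mathrm{span}\{I_i,d_{m+i}\mid i\ge0\}$. $\mathbb{C}w_{\phi_m}$ is the one-dimensional $\mathcal{L}^{(0,m)}+\sum_i\mathbb{C}z_i$-module with $xw_{\phi_m}=\phi_m(x)w_{\phi_m}$, and $\widetilde W_{\phi_m}=\mathrm{Ind}_{\mathcal{L}^{(0,m)}+\sum_i\mathbb{C}z_i}^{\mathcal L}\mathbb{C}w_{\phi_m}$. *)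

theory Defs
  imports Complex_Main
begin

(* Basis of the Lie algebra L: d_n, I_n (n :: int), z_1, z_2, z_3 *)
datatype gen = D int | I int | Z1 | Z2 | Z3

(* brk x y g = coefficient of basis vector g in the bracket [x,y] *)
fun brk :: "gen \<Rightarrow> gen \<Rightarrow> gen \<Rightarrow> complex" where
  "brk (D n) (D k) g =
     (if g = D (n + k) then of_int (k - n) else 0)
   + (if g = Z1 \<and> n = - k then of_int (n ^ 3 - n) / 12 else 0)"
| "brk (D n) (I k) g =
     (if g = I (k + n) then of_int k else 0)
   + (if g = Z2 \<and> n = - k then of_int (n ^ 2 + n) else 0)"
| "brk (I k) (D n) g =
   - ((if g = I (k + n) then of_int k else 0)
   + (if g = Z2 \<and> n = - k then of_int (n ^ 2 + n) else 0))"
| "brk (I n) (I k) g = (if g = Z3 \<and> n = - k then of_int n else 0)"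
| "brk _ _ g = 0"

definition bgen :: "int \<Rightarrow> gen set" where
  "bgen m = {g. \<exists>i\<ge>0. g = I i \<or> g = D (m + i)} \<union> {Z1, Z2, Z3}"

(* phi (given by its values on the basis bgen m, extended linearly) is a Lie algebra
   homomorphism to the abelian Lie algebra C: it kills all brackets *)
definition lie_hom_b :: "int \<Rightarrow> (gen \<Rightarrow> complex) \<Rightarrow> bool" where
  "lie_hom_b m \<phi> \<longleftrightarrow>
     (\<forall>x\<in>bgen m. \<forall>y\<in>bgen m. (\<Sum>g\<in>{g. brk x y g \<noteq> 0}. brk x y g * \<phi> g) = 0)"

(* Tensor algebra T(L): finitely supported functions on words in the basis *)
type_synonym tens = "gen list \<Rightarrow> complex"

definition fsupp :: "tens set" where
  "fsupp = {f. finite {l. f l \<noteq> 0}}"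

definition mono :: "gen list \<Rightarrow> tens" where
  "mono u = (\<lambda>l. if l = u then 1 else 0)"

definition tmul :: "tens \<Rightarrow> tens \<Rightarrow> tens" where
  "tmul f h = (\<lambda>l. \<Sum>k\<le>length l. f (take k l) * h (drop k l))"

(* x \<otimes> y - y \<otimes> x - [x,y] : generators of the ideal defining U(L) *)
definition lie_rel :: "gen \<Rightarrow> gen \<Rightarrow> tens" where
  "lie_rel x y = (\<lambda>l. mono [x, y] l - mono [y, x] l
                     - (case l of [g] \<Rightarrow> brk x y g | _ \<Rightarrow> 0))"

definition whit :: "(gen \<Rightarrow> complex) \<Rightarrow> gen \<Rightarrow> tens" where
  "whit \<phi> g = (\<lambda>l. mono [g] l - \<phi> g * mono [] l)"

(* K = (two-sided ideal defining U(L)) + T(L)(x - phi(x), x in the subalgebra);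
   then T(L)/K = U(L)/U(L){x - phi(x)} = Ind_{b}^{L} C w_phi *)
inductive_set Kid :: "int \<Rightarrow> (gen \<Rightarrow> complex) \<Rightarrow> tens set" for m \<phi> where
  zero: "(\<lambda>_. 0) \<in> Kid m \<phi>"
| add: "f \<in> Kid m \<phi> \<Longrightarrow> h \<in> Kid m \<phi> \<Longrightarrow> (\<lambda>l. f l + h l) \<in> Kid m \<phi>"
| smult: "f \<in> Kid m \<phi> \<Longrightarrow> (\<lambda>l. c * f l) \<in> Kid m \<phi>"
| rel: "tmul (mono u) (tmul (lie_rel x y) (mono v)) \<in> Kid m \<phi>"
| wh: "g \<in> bgen m \<Longrightarrow> tmul (mono u) (whit \<phi> g) \<in> Kid m \<phi>"

(* The universal Whittaker module W~_phi = T(L)/Kid m phi is simple: it is nonzero and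
   every L-submodule (= subspace S with Kid \<subseteq> S \<subseteq> T(L) stable under the
   action of all basis elements of L) is trivial. *)
definition whittaker_simple :: "int \<Rightarrow> (gen \<Rightarrow> complex) \<Rightarrow> bool" where
  "whittaker_simple m \<phi> \<longleftrightarrow>
     Kid m \<phi> \<noteq> fsupp \<and>
     (\<forall>S. Kid m \<phi> \<subseteq> S \<and> S \<subseteq> fsupp
          \<and> (\<forall>f\<in>S. \<forall>h\<in>S. (\<lambda>l. f l + h l) \<in> S)
          \<and> (\<forall>c. \<forall>f\<in>S. (\<lambda>l. c * f l) \<in> S)
          \<and> (\<forall>g. \<forall>f\<in>S. tmul (mono [g]) f \<in> S)
        \<longrightarrow> S = Kid m \<phi> \<or> S = fsupp)"

end

theory Submission
  imports Defs "HOL-Library.Function_Algebras" "HOL-Library.Multiset"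
begin

text \<open>
  A Poincare-Birkhoff-Witt argument (rewriting words by swapping descents and evaluating trailing
  elements of the subalgebra; all critical pairs resolve by the Jacobi identity) gives functionals
  on the tensor algebra that vanish on \<open>Kid\<close> and read off leading terms, so the module behaves
  like a filtered polynomial module in the \<open>I\<^sub>-\<^sub>j\<close> (\<open>j \<ge> 1\<close>) and
  \<open>d\<^sub>m\<^sub>-\<^sub>i\<close> (\<open>i \<ge> 1\<close>).

  If \<open>\<phi>(I\<^sub>m) \<noteq> 0\<close>, then up to terms of lower weight \<open>I\<^sub>k - \<phi>(I\<^sub>k)\<close> acts as
  \<open>- k \<phi>(I\<^sub>m)\<close> times the derivative with respect to \<open>d\<^sub>m\<^sub>-\<^sub>k\<close>, and, on polynomials in the
  \<open>I\<^sub>-\<^sub>j\<close> only, \<open>d\<^sub>m\<^sub>+\<^sub>j - \<phi>(d\<^sub>m\<^sub>+\<^sub>j)\<close> acts as \<open>- j \<phi>(I\<^sub>m)\<close> times the derivative with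
  respect to \<open>I\<^sub>-\<^sub>j\<close>. Hence every nonzero submodule contains the generator.

  If \<open>\<phi>(I\<^sub>m) = 0\<close>, a combination of \<open>d\<^sub>m\<^sub>-\<^sub>1\<close>, \<open>I\<^sub>-\<^sub>2\<close>, \<open>I\<^sub>-\<^sub>1\<close> (and \<open>I\<^sub>-\<^sub>1\<^sup>2\<close> when
  \<open>m = 1\<close>) is a Whittaker vector of positive degree. By comparing leading terms, the submodule it
  generates misses the generator of the module.
\<close>

section \<open>Brackets\<close>

text \<open>\<open>Kid\<close> is given only by generators, so the obstacle is to show that
  something is not in it. Functionals that see only the longest words suffice: there letters commute
  and the choice of an order disappears. No basis theorem is stated.

  Both derivatives come from one element: [I_k, d_{m-k}] = -k I_m and [d_{m+j}, I_{-j}] = -j I_m,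
  while \<phi>(I_l) = 0 for l > m because I_l is a multiple of [d_m, I_{l-m}]. With \<phi>(z_3) = 0
  all I_k commute modulo \<open>Kid\<close>. Hence the I_{-j} are inert while the d_{m-i} are
  removed, and the d_{m+j} are applied only after no d_{m-i} is left. The two stages use different
  weights.

  Conversely, for y among d_{m-1}, I_{-1}, I_{-2} the brackets [x, y] with x in the subalgebra stay
  in it, so the Whittaker condition becomes scalar equations, which for \<phi>(I_m) = 0 are
  nontrivial only at x = d_m and x = d_{m+1}. The one exception is [d_1, I_{-2}] = -2 I_{-1} when m
  = 1; the square of I_{-1} is there to cancel this stray I_{-1}.\<close>

definition scl :: "complex \<Rightarrow> tens \<Rightarrow> tens" where
  "scl c f = (\<lambda>l. c * f l)"

lemma scl_apply [simp]: "scl c f l = c * f l"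
  by (simp add: scl_def)

interpretation T: vector_space scl
  by unfold_locales (auto simp: fun_eq_iff algebra_simps)

text \<open>The linear extension of \<open>F\<close>, evaluated at [x, y]. With \<open>F\<close>
  left abstract, one set of formulas serves for \<phi>, for functionals on words and, nested, for
  iterated brackets.\<close>

definition bsum :: "gen \<Rightarrow> gen \<Rightarrow> (gen \<Rightarrow> complex) \<Rightarrow> complex" where
  "bsum x y F = (\<Sum>g\<in>{g. brk x y g \<noteq> 0}. brk x y g * F g)"

lemma brk_II: "brk (I n) (I k) g \<noteq> 0 \<Longrightarrow> g = Z3"
  by (auto split: if_splits)

lemma finite_brk [simp]: "finite {g. brk x y g \<noteq> 0}"
proof (cases x; cases y)
  fix n k assume "x = D n" "y = D k"
  then show ?thesis by (auto intro: finite_subset [of _ "{D (n + k), Z1}"] split: if_splits)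
next
  fix n k assume "x = D n" "y = I k"
  then show ?thesis by (auto intro: finite_subset [of _ "{I (k + n), Z2}"] split: if_splits)
next
  fix n k assume "x = I k" "y = D n"
  then show ?thesis by (auto intro: finite_subset [of _ "{I (k + n), Z2}"] split: if_splits)
next
  fix n k assume "x = I k" "y = I n"
  then show ?thesis by (auto intro: finite_subset [of _ "{Z3}"] split: if_splits)
qed auto

lemma bsum_superset:
  assumes "finite A" "\<And>g. brk x y g \<noteq> 0 \<Longrightarrow> g \<in> A"
  shows "bsum x y F = (\<Sum>g\<in>A. brk x y g * F g)"
  unfolding bsum_def by (rule sum.mono_neutral_left) (use assms in auto)

lemma bsum_DD: "bsum (D n) (D k) F =
    of_int (k - n) * F (D (n + k)) + (if n = - k then of_int (n ^ 3 - n) / 12 * F Z1 else 0)"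
  by (subst bsum_superset [where A = "{D (n + k), Z1}"]) (auto split: if_splits)

lemma bsum_DI: "bsum (D n) (I k) F =
    of_int k * F (I (k + n)) + (if n = - k then of_int (n ^ 2 + n) * F Z2 else 0)"
  by (subst bsum_superset [where A = "{I (k + n), Z2}"]) (auto split: if_splits)

lemma bsum_ID: "bsum (I k) (D n) F =
    - of_int k * F (I (k + n)) - (if n = - k then of_int (n ^ 2 + n) * F Z2 else 0)"
  by (subst bsum_superset [where A = "{I (k + n), Z2}"]) (auto split: if_splits)

lemma bsum_II: "bsum (I n) (I k) F = (if n = - k then of_int n * F Z3 else 0)"
  by (subst bsum_superset [where A = "{Z3}"]) (auto split: if_splits)

lemma brk_Z [simp]:
  "brk Z1 y g = 0" "brk Z2 y g = 0" "brk Z3 y g = 0"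
  "brk x Z1 g = 0" "brk x Z2 g = 0" "brk x Z3 g = 0"
  by (cases y; simp; fail | cases x; simp; fail)+

lemma bsum_Z [simp]:
  "bsum Z1 y F = 0" "bsum Z2 y F = 0" "bsum Z3 y F = 0"
  "bsum x Z1 F = 0" "bsum x Z2 F = 0" "bsum x Z3 F = 0"
  unfolding bsum_def by (simp_all add: brk_Z)

lemmas bsum_simps = bsum_DD bsum_DI bsum_ID bsum_II

lemma bsum_anti: "bsum y x F = - bsum x y F"
  by (cases x; cases y; simp add: bsum_simps)
     (auto simp: algebra_simps power3_eq_cube minus_equation_iff)

lemma bsum_self [simp]: "bsum x x F = 0"
  using bsum_anti [of x x F] by simp

lemma bsum_add: "bsum x y (\<lambda>g. F g + H g) = bsum x y F + bsum x y H"
  by (simp add: bsum_def algebra_simps sum.distrib)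

lemma bsum_mult_left: "bsum x y (\<lambda>g. c * F g) = c * bsum x y F"
  by (simp add: bsum_def sum_distrib_left mult.left_commute)

lemma bsum_mult_right: "bsum x y (\<lambda>g. F g * c) = bsum x y F * c"
  by (simp add: bsum_def sum_distrib_right mult.assoc)

lemma bsum_cong: "(\<And>g. brk x y g \<noteq> 0 \<Longrightarrow> F g = H g) \<Longrightarrow> bsum x y F = bsum x y H"
  by (simp add: bsum_def)

lemma bsum_swap:
  "bsum x y (\<lambda>g. bsum z w (\<lambda>h. F g h)) = bsum z w (\<lambda>h. bsum x y (\<lambda>g. F g h))"
  unfolding bsum_def sum_distrib_left
  by (subst sum.swap) (simp add: algebra_simps)

lemma bsum_zero [simp]: "bsum x y (\<lambda>g. 0) = 0"
  by (simp add: bsum_def)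

text \<open>Central terms occur only when the three indices sum to zero, hence the case split; there
  the three cocycle values cancel.\<close>

lemma jacobi_DDD: "bsum (D a) (D b) (\<lambda>g. bsum g (D c) F) + bsum (D b) (D c) (\<lambda>g. bsum g (D a) F)
  + bsum (D c) (D a) (\<lambda>g. bsum g (D b) F) = 0"
proof (cases "c = - a - b")
  case True
  then have "a + b = - c" "b + c = - a" "c + a = - b" by auto
  then show ?thesis
    by (simp only: bsum_DD bsum_Z if_cancel mult_zero_right add_0_right minus_minus if_True)
       (simp add: True field_simps power3_eq_cube)
next
  case False
  then have "a + b \<noteq> - c" "b + c \<noteq> - a" "c + a \<noteq> - b" by auto
  then show ?thesis
    by (simp add: bsum_DD ac_simps) (simp add: algebra_simps)
qed

lemma jacobi_DDI: "bsum (D a) (D b) (\<lambda>g. bsum g (I c) F) + bsum (D b) (I c) (\<lambda>g. bsum g (D a) F)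
  + bsum (I c) (D a) (\<lambda>g. bsum g (D b) F) = 0"
proof (cases "c = - a - b")
  case True
  show ?thesis unfolding True
    by (simp add: bsum_DD bsum_DI bsum_ID) (simp add: algebra_simps power2_eq_square)
next
  case False
  then have "a + b \<noteq> - c" "b + c \<noteq> - a" "c + a \<noteq> - b" "c + b \<noteq> - a" "a \<noteq> -(c+b)" "b \<noteq> -(c+a)" by auto
  then show ?thesis
    by (simp add: bsum_DD bsum_DI bsum_ID ac_simps) (simp add: algebra_simps)
qed

lemma jacobi_DII: "bsum (D a) (I b) (\<lambda>g. bsum g (I c) F) + bsum (I b) (I c) (\<lambda>g. bsum g (D a) F)
  + bsum (I c) (D a) (\<lambda>g. bsum g (I b) F) = 0"
proof (cases "c = - a - b")
  case True
  show ?thesis unfolding True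
    by (simp add: bsum_II bsum_DI bsum_ID algebra_simps)
next
  case False
  then have "a + b \<noteq> - c" "b + a \<noteq> - c" "c + a \<noteq> - b" by auto
  then show ?thesis
    by (simp add: bsum_II bsum_DI bsum_ID)
qed

text \<open>The sum is invariant under cyclic rotation, so the three mixed cases cover all types up
  to rotation; triples of three \<open>I\<close>s or with a central element give only zero
  terms.\<close>

lemma bsum_jacobi:
  "bsum x y (\<lambda>g. bsum g z F) + bsum y z (\<lambda>g. bsum g x F) + bsum z x (\<lambda>g. bsum g y F) = 0"
proof -
  have rot: "q + r + p = 0" if "p + q + r = 0" for p q r :: complex
    using that by (simp add: algebra_simps)
  show ?thesis
    by (cases x; cases y; cases z;
        simp add: bsum_II jacobi_DDD jacobi_DDI rot [OF jacobi_DDI] rot [OF rot [OF jacobi_DDI]]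
          jacobi_DII [unfolded bsum_II] rot [OF jacobi_DII, unfolded bsum_II]
          rot [OF rot [OF jacobi_DII], unfolded bsum_II]
          flip: add.assoc)
qed

definition comm :: "gen \<Rightarrow> gen \<Rightarrow> (gen \<Rightarrow> tens) \<Rightarrow> tens" where
  "comm x y F = (\<Sum>g\<in>{g. brk x y g \<noteq> 0}. scl (brk x y g) (F g))"

lemma sum_fun_apply: "(\<Sum>a\<in>A. (F a :: tens)) l = (\<Sum>a\<in>A. F a l)"
  by (induction A rule: infinite_finite_induct) auto

lemma comm_apply: "comm x y F l = bsum x y (\<lambda>g. F g l)"
  by (simp add: comm_def bsum_def sum_fun_apply)

section \<open>The normal form functional\<close>

text \<open>Sorting by this rank pushes the letters of the subalgebra (nonnegative rank) to the
  right end, where \<phi> can evaluate them. Parity separates the \<open>I\<close>s from the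
  \<open>D\<close>s, and the shifts by 4 and 3 leave 0, 1, 2 for the central elements.\<close>

definition pkey :: "int \<Rightarrow> gen \<Rightarrow> int" where
  "pkey m g = (case g of
     D n \<Rightarrow> (if n < m then 2 * (n - m) + 1 else 2 * (n - m) + 3)
   | I k \<Rightarrow> (if k < 0 then 2 * k else 2 * k + 4)
   | Z1 \<Rightarrow> 0 | Z2 \<Rightarrow> 1 | Z3 \<Rightarrow> 2)"

lemma pkey_inject: "pkey m x = pkey m y \<Longrightarrow> x = y"
  by (cases x; cases y; simp add: pkey_def split: if_splits; presburger)

lemma bgen_iff_pkey: "g \<in> bgen m \<longleftrightarrow> 0 \<le> pkey m g"
proof (cases g)
  case (D n)
  have "(\<exists>i\<ge>0. n = m + i) \<longleftrightarrow> m \<le> n"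
    by (metis add.commute diff_add_cancel diff_ge_0_iff_ge le_add_same_cancel1)
  with D show ?thesis by (auto simp: bgen_def pkey_def)
qed (auto simp: bgen_def pkey_def)

fun invs :: "(gen \<Rightarrow> int) \<Rightarrow> gen list \<Rightarrow> nat" where
  "invs key [] = 0"
| "invs key (x # xs) = length (filter (\<lambda>y. key y < key x) xs) + invs key xs"

lemma invs_swap: "key y < key x \<Longrightarrow> invs key (u @ x # y # v) = Suc (invs key (u @ y # x # v))"
  by (induction u) auto

definition descent :: "(gen \<Rightarrow> int) \<Rightarrow> gen list \<Rightarrow> gen list \<times> gen \<times> gen \<times> gen list \<Rightarrow> bool" where
  "descent key l = (\<lambda>(u, x, y, v). l = u @ x # y # v \<and> key y < key x)"

locale whittaker =
  fixes m :: int and \<phi> :: "gen \<Rightarrow> complex"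
  assumes m_pos: "1 \<le> m" and hom: "lie_hom_b m \<phi>"
begin

abbreviation key :: "gen \<Rightarrow> int" where "key \<equiv> pkey m"

text \<open>The descent is an arbitrary choice here; the result does not depend on it by
  \<open>critical_pair\<close>.\<close>

function nf :: "(gen list \<Rightarrow> complex) \<Rightarrow> gen list \<Rightarrow> complex" where
  "nf \<tau> l =
    (if \<exists>d. descent key l d
     then (case (SOME d. descent key l d) of (u, x, y, v) \<Rightarrow>
       nf \<tau> (u @ y # x # v) + (\<Sum>g\<in>{g. brk x y g \<noteq> 0}. brk x y g * nf \<tau> (u @ g # v)))
     else if l \<noteq> [] \<and> last l \<in> bgen m then \<phi> (last l) * nf \<tau> (butlast l)
     else \<tau> l)"
  by pat_completeness auto
termination
\<comment> \<open>A swap keeps the length and removes one inversion; bracket terms and evaluation of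
  the last letter shorten the word.\<close>
proof (relation "measures [\<lambda>(\<tau>, l). length l, \<lambda>(\<tau>, l). invs key l]", goal_cases)
  case 1 show ?case by simp
next
  case (2 \<tau> l u p x q y v)
  then have "descent key l (u, x, y, v)" by (metis someI_ex)
  then have "l = u @ x # y # v" "key y < key x" by (simp_all add: descent_def)
  then show ?case using invs_swap [of key y x u v] by simp
next
  case (3 \<tau> l u p x q y v g)
  then have "descent key l (u, x, y, v)" by (metis someI_ex)
  then have "l = u @ x # y # v" by (simp add: descent_def)
  then show ?case by simp
next
  case (4 \<tau> l)
  then show ?case by simp
qed

declare nf.simps [simp del]

section \<open>Confluence of the rewriting\<close>

definition nf_at :: "(gen list \<Rightarrow> complex) \<Rightarrow> gen list \<times> gen \<times> gen \<times> gen list \<Rightarrow> complex" where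
  "nf_at \<tau> = (\<lambda>(u, x, y, v). nf \<tau> (u @ y # x # v) + bsum x y (\<lambda>g. nf \<tau> (u @ g # v)))"

lemma nf_cases:
  obtains (descent) d where "descent key l d" "nf \<tau> l = nf_at \<tau> d"
  | (last) "\<nexists>d. descent key l d" "l \<noteq> []" "last l \<in> bgen m" "nf \<tau> l = \<phi> (last l) * nf \<tau> (butlast l)"
  | (normal) "\<nexists>d. descent key l d" "l = [] \<or> last l \<notin> bgen m" "nf \<tau> l = \<tau> l"
proof (cases "\<exists>d. descent key l d")
  case True
  then have "descent key l (SOME d. descent key l d)" by (rule someI_ex)
  moreover have "nf \<tau> l = nf_at \<tau> (SOME d. descent key l d)"
    using True by (subst nf.simps) (auto simp: nf_at_def bsum_def split: prod.split)
  ultimately show ?thesis using that(1) by blast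
next
  case False
  then have "nf \<tau> l = (if l \<noteq> [] \<and> last l \<in> bgen m then \<phi> (last l) * nf \<tau> (butlast l) else \<tau> l)"
    by (subst nf.simps) simp
  with False show ?thesis using that(2,3) by (auto split: if_splits)
qed

text \<open>Compatibility with xy - yx = [x, y] at every adjacent pair. The weaker
  \<open>dswaps\<close> asks for it only at descents, where an induction on inversions can
  work.\<close>

definition swaps :: "(gen list \<Rightarrow> complex) \<Rightarrow> gen list \<Rightarrow> bool" where
  "swaps \<tau> l \<longleftrightarrow> (\<forall>u x y v. l = u @ x # y # v \<longrightarrow> nf \<tau> l = nf_at \<tau> (u, x, y, v))"

definition dswaps :: "(gen list \<Rightarrow> complex) \<Rightarrow> gen list \<Rightarrow> bool" where
  "dswaps \<tau> l \<longleftrightarrow> (\<forall>d. descent key l d \<longrightarrow> nf \<tau> l = nf_at \<tau> d)"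

lemma swapsD: "swaps \<tau> (u @ x # y # v) \<Longrightarrow>
    nf \<tau> (u @ x # y # v) = nf \<tau> (u @ y # x # v) + bsum x y (\<lambda>g. nf \<tau> (u @ g # v))"
  by (auto simp: swaps_def nf_at_def)

lemma dswapsD: "dswaps \<tau> (u @ x # y # v) \<Longrightarrow> key y < key x \<Longrightarrow>
    nf \<tau> (u @ x # y # v) = nf \<tau> (u @ y # x # v) + bsum x y (\<lambda>g. nf \<tau> (u @ g # v))"
  by (force simp: dswaps_def nf_at_def descent_def)

text \<open>Two descents of one word coincide, overlap in one letter, or are disjoint. For an
  overlap, rewriting both sides down to the sorted triple leaves a difference that is the Jacobi
  sum. For disjoint descents it is a double sum over two brackets, taken in the two possible
  orders.\<close>

lemma critical_pair:
  assumes d: "descent key l (u, x, y, v)" and d': "descent key l (u', x', y', v')"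
    and len: "length u \<le> length u'"
    and short: "\<And>l'. length l' < length l \<Longrightarrow> swaps \<tau> l'"
    and same: "\<And>l'. length l' = length l \<Longrightarrow> invs key l' < invs key l \<Longrightarrow> dswaps \<tau> l'"
  shows "nf_at \<tau> (u, x, y, v) = nf_at \<tau> (u', x', y', v')"
proof -
  have l: "l = u @ x # y # v" "key y < key x" "l = u' @ x' # y' # v'" "key y' < key x'"
    using d d' by (auto simp: descent_def)
  obtain w where u': "u' = u @ w" "x # y # v = w @ x' # y' # v'"
  proof
    have "take (length u) u' = u"
      using arg_cong [OF l(1)[unfolded l(3)], of "take (length u)"] len by simp
    then show "u' = u @ drop (length u) u'" by (metis append_take_drop_id)
    show "x # y # v = drop (length u) u' @ x' # y' # v'"
      using arg_cong [OF l(1)[unfolded l(3)], of "drop (length u)"] len by simp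
  qed
  consider "w = []" | "w = [x]" | w' where "w = x # y # w'"
    using u'(2) by (cases w; cases "tl w") auto
  then show ?thesis
  proof cases
    case 1
    then show ?thesis using u' by auto
  next
    case 2
    then have e: "u' = u @ [x]" "x' = y" "v = y' # v'" using u' by auto
    let ?z = y' and ?v = v'
    have l1: "l = u @ x # y # ?z # ?v" using l e by simp
    have i1: "invs key l = Suc (invs key (u @ y # x # ?z # ?v))"
      unfolding l1 by (rule invs_swap) (use l in simp)
    have i2: "invs key l = Suc (invs key (u @ x # ?z # y # ?v))"
      unfolding l1 using invs_swap [of key ?z y "u @ [x]" ?v] l e by simp
    have yz: "key ?z < key y" and xy: "key y < key x" using l e by auto
    have a1: "nf \<tau> (u @ y # x # ?z # ?v) =
        nf \<tau> (u @ y # ?z # x # ?v) + bsum x ?z (\<lambda>g. nf \<tau> (u @ y # g # ?v))"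
      using dswapsD [of \<tau> "u @ [y]" x ?z ?v] same [of "u @ y # x # ?z # ?v"] i1 l1 yz xy by simp
    have i3: "invs key (u @ y # x # ?z # ?v) = Suc (invs key (u @ y # ?z # x # ?v))"
      using invs_swap [of key ?z x "u @ [y]" ?v] yz xy by simp
    have a2: "nf \<tau> (u @ y # ?z # x # ?v) =
        nf \<tau> (u @ ?z # y # x # ?v) + bsum y ?z (\<lambda>g. nf \<tau> (u @ g # x # ?v))"
      using dswapsD [of \<tau> u y ?z "x # ?v"] same [of "u @ y # ?z # x # ?v"] i1 i3 l1 yz by simp
    have a3: "nf \<tau> (u @ x # ?z # y # ?v) =
        nf \<tau> (u @ ?z # x # y # ?v) + bsum x ?z (\<lambda>g. nf \<tau> (u @ g # y # ?v))"
      using dswapsD [of \<tau> u x ?z "y # ?v"] same [of "u @ x # ?z # y # ?v"] i2 l1 yz xy by simp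
    have i4: "invs key (u @ x # ?z # y # ?v) = Suc (invs key (u @ ?z # x # y # ?v))"
      using invs_swap [of key ?z x u "y # ?v"] yz xy by simp
    have a4: "nf \<tau> (u @ ?z # x # y # ?v) =
        nf \<tau> (u @ ?z # y # x # ?v) + bsum x y (\<lambda>g. nf \<tau> (u @ ?z # g # ?v))"
      using dswapsD [of \<tau> "u @ [?z]" x y ?v] same [of "u @ ?z # x # y # ?v"] i2 i4 l1 xy by simp
    \<comment> \<open>A letter \<open>g\<close> coming from a bracket need not form a descent with
      its neighbour, so for shorter words the relation is needed at all pairs.\<close>
    have sh: "nf \<tau> (u @ g # h # ?v) = nf \<tau> (u @ h # g # ?v) + bsum g h (\<lambda>k. nf \<tau> (u @ k # ?v))" for g h
      by (rule swapsD) (rule short, simp add: l1)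
    have b1: "bsum x y (\<lambda>g. nf \<tau> (u @ g # ?z # ?v)) =
       bsum x y (\<lambda>g. nf \<tau> (u @ ?z # g # ?v)) + bsum x y (\<lambda>g. bsum g ?z (\<lambda>k. nf \<tau> (u @ k # ?v)))"
      by (subst sh) (rule bsum_add)
    have b2: "bsum y ?z (\<lambda>g. nf \<tau> (u @ g # x # ?v)) =
       bsum y ?z (\<lambda>g. nf \<tau> (u @ x # g # ?v)) + bsum y ?z (\<lambda>g. bsum g x (\<lambda>k. nf \<tau> (u @ k # ?v)))"
      by (subst sh) (rule bsum_add)
    have b3: "bsum x ?z (\<lambda>g. nf \<tau> (u @ g # y # ?v)) =
       bsum x ?z (\<lambda>g. nf \<tau> (u @ y # g # ?v)) - bsum ?z x (\<lambda>g. bsum g y (\<lambda>k. nf \<tau> (u @ k # ?v)))"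
      by (subst sh) (simp add: bsum_add bsum_anti [of x ?z])
    show ?thesis
      unfolding nf_at_def prod.case e
      using bsum_jacobi [of x y ?z "\<lambda>k. nf \<tau> (u @ k # ?v)"]
      by (simp add: a1 a2 a3 a4 b1 b2 b3 algebra_simps)
  next
    case 3
    then have e: "u' = u @ x # y # w'" "v = w' @ x' # y' # v'" using u' by auto
    have l1: "l = u @ x # y # w' @ x' # y' # v'" using l e by simp
    have xy: "key y < key x" and xy': "key y' < key x'" using l by auto
    have "invs key l = Suc (invs key (u @ y # x # w' @ x' # y' # v'))"
      unfolding l1 by (rule invs_swap) (use l in simp)
    then have a1: "nf \<tau> (u @ y # x # w' @ x' # y' # v') = nf \<tau> (u @ y # x # w' @ y' # x' # v') +
        bsum x' y' (\<lambda>g. nf \<tau> (u @ y # x # w' @ g # v'))"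
      using dswapsD [of \<tau> "u @ y # x # w'" x' y' v'] same [of "u @ y # x # w' @ x' # y' # v'"] l1 xy' by simp
    have "invs key l = Suc (invs key (u @ x # y # w' @ y' # x' # v'))"
      unfolding l1 using invs_swap [of key y' x' "u @ x # y # w'" v'] l by simp
    then have a2: "nf \<tau> (u @ x # y # w' @ y' # x' # v') = nf \<tau> (u @ y # x # w' @ y' # x' # v') +
        bsum x y (\<lambda>g. nf \<tau> (u @ g # w' @ y' # x' # v'))"
      using dswapsD [of \<tau> u x y "w' @ y' # x' # v'"] same [of "u @ x # y # w' @ y' # x' # v'"] l1 xy by simp
    have s1: "nf \<tau> (u @ g # w' @ x' # y' # v') = nf \<tau> (u @ g # w' @ y' # x' # v') +
        bsum x' y' (\<lambda>h. nf \<tau> (u @ g # w' @ h # v'))" for g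
      using swapsD [of \<tau> "u @ g # w'" x' y' v'] short [of "u @ g # w' @ x' # y' # v'"] l1 by simp
    have s2: "nf \<tau> (u @ x # y # w' @ g # v') = nf \<tau> (u @ y # x # w' @ g # v') +
        bsum x y (\<lambda>h. nf \<tau> (u @ h # w' @ g # v'))" for g
      using swapsD [of \<tau> u x y "w' @ g # v'"] short [of "u @ x # y # w' @ g # v'"] l1 by simp
    show ?thesis
      unfolding nf_at_def prod.case e
      using bsum_swap [of x y x' y' "\<lambda>g h. nf \<tau> (u @ g # w' @ h # v')"]
      by (simp add: a1 a2 s1 s2 bsum_add)
  qed
qed

text \<open>\<open>nf\<close> rewrites at one chosen descent, so it is enough to compare any other
  descent with the chosen one; the induction on inversions supplies the words of equal length that
  \<open>critical_pair\<close> asks for.\<close>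

lemma dswaps_step:
  assumes short: "\<And>l'. length l' < length l \<Longrightarrow> swaps \<tau> l'"
  shows "dswaps \<tau> l"
  using short
proof (induction "invs key l" arbitrary: l rule: less_induct)
  case less
  have same: "dswaps \<tau> l'" if "length l' = length l" "invs key l' < invs key l" for l'
    using less that by simp
  show ?case
    unfolding dswaps_def
  proof (intro allI impI)
    fix d assume d: "descent key l d"
    obtain d' where d': "descent key l d'" "nf \<tau> l = nf_at \<tau> d'"
      using nf_cases [of l \<tau>] d by metis
    obtain u x y v u' x' y' v' where e: "d = (u, x, y, v)" "d' = (u', x', y', v')"
      by (metis surj_pair)
    have "nf_at \<tau> d = nf_at \<tau> d'"
    proof (cases "length u \<le> length u'")
      case True
      then show ?thesis
        using critical_pair [of l u x y v u' x' y' v' \<tau>] d d'(1) e less.prems same by simp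
    next
      case False
      then show ?thesis
        using critical_pair [of l u' x' y' v' u x y v \<tau>] d d'(1) e less.prems same by simp
    qed
    with d' show "nf \<tau> l = nf_at \<tau> d" by simp
  qed
qed

text \<open>At an ascent, the relation is that of the swapped word read backwards, by antisymmetry
  of the bracket. Since the rank is injective, the only other pairs are equal letters, with bracket
  zero.\<close>

lemma swaps_all: "swaps \<tau> l"
proof (induction "length l" arbitrary: l rule: less_induct)
  case less
  have d: "dswaps \<tau> l'" if "length l' = length l" for l'
    by (rule dswaps_step) (use less that in simp)
  show ?case
    unfolding swaps_def
  proof (intro allI impI)
    fix u x y v assume l: "l = u @ x # y # v"
    consider "key y < key x" | "key x < key y" | "x = y"
      using pkey_inject by force
    then show "nf \<tau> l = nf_at \<tau> (u, x, y, v)"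
    proof cases
      case 1
      with d [of l] l show ?thesis by (simp add: dswaps_def descent_def)
    next
      case 2
      with d [of "u @ y # x # v"] l show ?thesis
        by (simp add: dswapsD nf_at_def bsum_anti [of x y])
    next
      case 3
      with l show ?thesis by (simp add: nf_at_def)
    qed
  qed
qed

lemmas nf_swap = swapsD [OF swaps_all]

lemma bsum_hom: "x \<in> bgen m \<Longrightarrow> y \<in> bgen m \<Longrightarrow> bsum x y \<phi> = 0"
  using hom unfolding lie_hom_b_def bsum_def by blast

lemma brk_bgen: "x \<in> bgen m \<Longrightarrow> y \<in> bgen m \<Longrightarrow> brk x y g \<noteq> 0 \<Longrightarrow> g \<in> bgen m"
  using m_pos unfolding bgen_iff_pkey
  by (cases x; cases y; auto simp: pkey_def split: if_splits)

text \<open>With no descent left this is the defining equation. A descent inside \<open>u\<close> is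
  rewritten alike on both sides. If the descent involves \<open>g\<close>, its left neighbour has
  larger rank, so it lies in the subalgebra too, and the bracket terms add up to a multiple of
  \<phi> of a bracket, which is 0.\<close>

lemma nf_snoc: "g \<in> bgen m \<Longrightarrow> nf \<tau> (u @ [g]) = \<phi> g * nf \<tau> u"
proof (induction "length u" arbitrary: u g rule: less_induct)
  case less
  from less.prems less.hyps show ?case
  proof (induction "invs key (u @ [g])" arbitrary: u g rule: less_induct)
    case less
    note IH = less.hyps and short = less.prems(2) and g = less.prems(1)
    show ?case
    proof (cases rule: nf_cases [of "u @ [g]" \<tau>])
      case (descent d)
      obtain a x y b where d: "d = (a, x, y, b)" by (metis surj_pair)
      have eq: "u @ [g] = a @ x # y # b" and xy: "key y < key x"
        using descent d by (auto simp: descent_def)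
      have inv: "invs key (a @ y # x # b) < invs key (u @ [g])"
        unfolding eq using invs_swap [OF xy] by simp
      show ?thesis
      proof (cases b rule: rev_cases)
        case Nil
        with eq have u: "u = a @ [x]" "g = y" by auto
        have x: "x \<in> bgen m" using g xy u by (simp add: bgen_iff_pkey)
        have "nf \<tau> (u @ [g]) = nf \<tau> ((a @ [y]) @ [x]) + bsum x y (\<lambda>k. nf \<tau> (a @ [k]))"
          using nf_swap [of \<tau> a x y "[]"] u by simp
        also have "bsum x y (\<lambda>k. nf \<tau> (a @ [k])) = bsum x y (\<lambda>k. \<phi> k * nf \<tau> a)"
        proof (rule bsum_cong)
          fix k assume "brk x y k \<noteq> 0"
          with brk_bgen x g u have "k \<in> bgen m" by blast
          then show "nf \<tau> (a @ [k]) = \<phi> k * nf \<tau> a" using short u by simp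
        qed
        also have "\<dots> = 0"
          using bsum_hom x g u by (simp add: bsum_mult_right)
        also have "nf \<tau> ((a @ [y]) @ [x]) = \<phi> x * nf \<tau> (a @ [y])"
          by (rule IH) (use inv Nil u x short in simp_all)
        also have "nf \<tau> (a @ [y]) = \<phi> y * nf \<tau> a"
          using short [of a y] g u by simp
        finally show ?thesis using short [of a x] x u by simp
      next
        case (snoc b' g')
        with eq have u: "u = a @ x # y # b'" "g' = g" by auto
        have "nf \<tau> (u @ [g]) = nf \<tau> ((a @ y # x # b') @ [g]) + bsum x y (\<lambda>k. nf \<tau> ((a @ k # b') @ [g]))"
          using nf_swap [of \<tau> a x y b] snoc u by simp
        also have "nf \<tau> ((a @ y # x # b') @ [g]) = \<phi> g * nf \<tau> (a @ y # x # b')"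
          by (rule IH) (use inv snoc u g short in simp_all)
        also have "bsum x y (\<lambda>k. nf \<tau> ((a @ k # b') @ [g])) = bsum x y (\<lambda>k. \<phi> g * nf \<tau> (a @ k # b'))"
          by (rule bsum_cong) (rule short, use u g in simp_all)
        finally show ?thesis
          using nf_swap [of \<tau> a x y b'] u by (simp add: bsum_mult_left algebra_simps)
      qed
    next
      case last
      then show ?thesis by simp
    next
      case normal
      with g show ?thesis by simp
    qed
  qed
qed

text \<open>Meant as the terminal value of \<open>nf\<close>: for \<open>M\<close> outside the
  subalgebra, \<open>nf (lead M)\<close> reads off the coefficient of the commutative monomial
  \<open>M\<close> among words of length \<open>size M\<close>.\<close>

definition lead :: "gen multiset \<Rightarrow> gen list \<Rightarrow> complex" where
  "lead M l = (if mset l = M then 1 else 0)"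

text \<open>No rewriting step lengthens a word, so a word with multiset \<open>M\<close> is never
  reached.\<close>

lemma nf_lead_short: "length l < size M \<Longrightarrow> nf (lead M) l = 0"
proof (induction "length l" arbitrary: l rule: less_induct)
  case less
  from less.prems less.hyps show ?case
  proof (induction "invs key l" arbitrary: l rule: less_induct)
    case less
    note IH = less.hyps and len = less.prems(1) and short = less.prems(2)
    show ?case
    proof (cases rule: nf_cases [of l "lead M"])
      case (descent d)
      obtain u x y v where d: "d = (u, x, y, v)" by (metis surj_pair)
      have l: "l = u @ x # y # v" and xy: "key y < key x"
        using descent d by (auto simp: descent_def)
      have "nf (lead M) (u @ y # x # v) = 0"
        by (rule IH) (use l len short invs_swap [OF xy] in auto)
      moreover have "bsum x y (\<lambda>g. nf (lead M) (u @ g # v)) = bsum x y (\<lambda>g. 0)"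
        by (rule bsum_cong, rule short) (use l len in auto)
      ultimately show ?thesis using l nf_swap [of "lead M" u x y v] by simp
    next
      case last
      then show ?thesis using short [of "butlast l"] len by simp
    next
      case normal
      then show ?thesis using len by (auto simp: lead_def)
    qed
  qed
qed

text \<open>At this length only reordering is visible, and it keeps the multiset; brackets and
  evaluations lead to shorter words, where the functional vanishes. A word ending in the subalgebra
  does not have multiset \<open>M\<close>, so both sides are 0.\<close>

lemma nf_lead:
  assumes "\<And>g. g \<in># M \<Longrightarrow> g \<notin> bgen m"
  shows "length l = size M \<Longrightarrow> nf (lead M) l = lead M l"
proof (induction "invs key l" arbitrary: l rule: less_induct)
  case less
  show ?case
  proof (cases rule: nf_cases [of l "lead M"])
    case (descent d)
    obtain u x y v where d: "d = (u, x, y, v)" by (metis surj_pair)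
    have l: "l = u @ x # y # v" and xy: "key y < key x"
      using descent d by (auto simp: descent_def)
    have "nf (lead M) (u @ y # x # v) = lead M (u @ y # x # v)"
      by (rule less.hyps) (use l less.prems invs_swap [OF xy] in auto)
    moreover have "lead M (u @ y # x # v) = lead M l"
      by (simp add: lead_def l add_mset_commute)
    moreover have "bsum x y (\<lambda>g. nf (lead M) (u @ g # v)) = bsum x y (\<lambda>g. 0)"
      by (rule bsum_cong, rule nf_lead_short) (use l less.prems in auto)
    ultimately show ?thesis using l nf_swap [of "lead M" u x y v] by simp
  next
    case last
    then have "mset l \<noteq> M" using assms last_in_set by (metis set_mset_mset)
    then show ?thesis using last nf_lead_short [of "butlast l" M] less.prems
      by (cases l) (simp_all add: lead_def)
  next
    case normal
    then show ?thesis by simp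
  qed
qed

end

section \<open>The tensor algebra and the submodule of relations\<close>

lemma mono_apply: "mono u l = (if l = u then 1 else 0)"
  by (simp add: mono_def)

lemma fsupp_subspace: "T.subspace fsupp"
proof (rule T.subspaceI)
  show "0 \<in> fsupp" by (simp add: fsupp_def zero_fun_def)
next
  fix f h assume "f \<in> fsupp" "h \<in> fsupp"
  then have "finite ({l. f l \<noteq> 0} \<union> {l. h l \<noteq> 0})" by (simp add: fsupp_def)
  then show "f + h \<in> fsupp"
    unfolding fsupp_def mem_Collect_eq by (rule rev_finite_subset) auto
next
  fix c f assume "f \<in> fsupp"
  then have "finite {l. f l \<noteq> 0}" by (simp add: fsupp_def)
  then show "scl c f \<in> fsupp"
    unfolding fsupp_def mem_Collect_eq by (rule rev_finite_subset) auto
qed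

lemma mono_fsupp [simp]: "mono u \<in> fsupp"
  by (simp add: fsupp_def mono_apply)

lemma sum_mono_eq: "finite A \<Longrightarrow> {l. f l \<noteq> 0} \<subseteq> A \<Longrightarrow> f = (\<Sum>l\<in>A. scl (f l) (mono l))"
  by (auto simp: fun_eq_iff sum_fun_apply mono_apply if_distrib [of "(*) _"] cong: if_cong)

lemma fsupp_eq_sum: "f \<in> fsupp \<Longrightarrow> f = (\<Sum>l\<in>{l. f l \<noteq> 0}. scl (f l) (mono l))"
  by (rule sum_mono_eq) (auto simp: fsupp_def)

definition fsupp_on :: "gen list set \<Rightarrow> tens set" where
  "fsupp_on W = {f \<in> fsupp. \<forall>l. f l \<noteq> 0 \<longrightarrow> l \<in> W}"

lemma fsupp_on_subspace: "T.subspace (fsupp_on W)"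
proof (rule T.subspaceI)
  show "0 \<in> fsupp_on W"
    using T.subspace_0 [OF fsupp_subspace] by (simp add: fsupp_on_def)
next
  fix f h assume "f \<in> fsupp_on W" "h \<in> fsupp_on W"
  then show "f + h \<in> fsupp_on W"
    using T.subspace_add [OF fsupp_subspace, of f h] by (simp add: fsupp_on_def) (metis add_0)
next
  fix c f assume "f \<in> fsupp_on W"
  then show "scl c f \<in> fsupp_on W"
    using T.subspace_scale [OF fsupp_subspace, of f c] by (simp add: fsupp_on_def)
qed

lemma span_monos: "T.span (mono ` W) = fsupp_on W"
proof
  show "T.span (mono ` W) \<subseteq> fsupp_on W"
    by (rule T.span_minimal [OF _ fsupp_on_subspace]) (auto simp: fsupp_on_def mono_apply split: if_splits)
next
  show "fsupp_on W \<subseteq> T.span (mono ` W)"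
  proof
    fix f assume f: "f \<in> fsupp_on W"
    then have "f = (\<Sum>l\<in>{l. f l \<noteq> 0}. scl (f l) (mono l))"
      by (simp add: fsupp_on_def fsupp_eq_sum)
    also have "\<dots> \<in> T.span (mono ` W)"
      by (rule T.span_sum) (use f in \<open>auto simp: fsupp_on_def intro: T.span_scale T.span_base\<close>)
    finally show "f \<in> T.span (mono ` W)" .
  qed
qed

lemma tmul_add_left: "tmul (f + f') h = tmul f h + tmul f' h"
  by (simp add: tmul_def fun_eq_iff algebra_simps sum.distrib)

lemma tmul_add_right: "tmul f (h + h') = tmul f h + tmul f h'"
  by (simp add: tmul_def fun_eq_iff algebra_simps sum.distrib)

lemma tmul_diff_left: "tmul (f - f') h = tmul f h - tmul f' h"
  by (simp add: tmul_def fun_eq_iff algebra_simps sum_subtractf)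

lemma tmul_diff_right: "tmul f (h - h') = tmul f h - tmul f h'"
  by (simp add: tmul_def fun_eq_iff algebra_simps sum_subtractf)

lemma tmul_scl_left: "tmul (scl c f) h = scl c (tmul f h)"
  by (simp add: tmul_def fun_eq_iff sum_distrib_left mult.assoc)

lemma tmul_scl_right: "tmul f (scl c h) = scl c (tmul f h)"
  by (simp add: tmul_def fun_eq_iff sum_distrib_left mult.left_commute)

lemma tmul_zero [simp]: "tmul 0 h = 0" "tmul f 0 = 0"
  by (simp_all add: tmul_def fun_eq_iff)

lemma tmul_sum_left: "tmul (\<Sum>a\<in>A. F a) h = (\<Sum>a\<in>A. tmul (F a) h)"
  unfolding tmul_def fun_eq_iff sum_fun_apply sum_distrib_right
  by (intro allI sum.swap)

lemma tmul_sum_right: "tmul f (\<Sum>a\<in>A. F a) = (\<Sum>a\<in>A. tmul f (F a))"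
  unfolding tmul_def fun_eq_iff sum_fun_apply sum_distrib_left
  by (intro allI sum.swap)

lemmas tmul_linear = tmul_add_left tmul_add_right tmul_diff_left tmul_diff_right
  tmul_scl_left tmul_scl_right tmul_sum_left tmul_sum_right

lemma tmul_comm_left: "tmul (comm x y F) h = comm x y (\<lambda>g. tmul (F g) h)"
  by (simp add: comm_def tmul_linear)

lemma tmul_comm_right: "tmul f (comm x y F) = comm x y (\<lambda>g. tmul f (F g))"
  by (simp add: comm_def tmul_linear)

lemma tmul_mono_left:
  "tmul (mono u) f l = (if take (length u) l = u then f (drop (length u) l) else 0)"
proof -
  have "tmul (mono u) f l = (\<Sum>k\<le>length l. if k = length u \<and> take k l = u then f (drop k l) else 0)"
    unfolding tmul_def by (rule sum.cong) (auto simp: mono_apply)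
  also have "\<dots> = (if take (length u) l = u then f (drop (length u) l) else 0)"
  proof (cases "take (length u) l = u")
    case True
    then have "length u \<le> length l" by (metis length_take min.cobounded1 min.absorb_iff2 min_def)
    with True have "(\<Sum>k\<le>length l. if k = length u \<and> take k l = u then f (drop k l) else 0) =
       (\<Sum>k\<le>length l. if k = length u then f (drop k l) else 0)"
      by (intro sum.cong) auto
    with True \<open>length u \<le> length l\<close> show ?thesis by simp
  next
    case False
    then show ?thesis by (intro trans [OF sum.neutral]) auto
  qed
  finally show ?thesis .
qed

lemma tmul_mono_mono [simp]: "tmul (mono u) (mono v) = mono (u @ v)"
proof
  fix l
  have "take (length u) l = u \<and> drop (length u) l = v \<longleftrightarrow> l = u @ v"
    by (metis append_take_drop_id append_eq_conv_conj)
  then show "tmul (mono u) (mono v) l = mono (u @ v) l"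
    by (auto simp: tmul_mono_left mono_apply)
qed

lemma tmul_mono_append: "tmul (mono (u @ v)) f = tmul (mono u) (tmul (mono v) f)"
proof
  fix l
  have "take (length (u @ v)) l = u @ v \<longleftrightarrow>
      take (length u) l = u \<and> take (length v) (drop (length u) l) = v"
    (is "?L \<longleftrightarrow> ?R")
  proof
    assume L: ?L
    have "take (length u) (take (length (u @ v)) l) = u" by (simp only: L) simp
    moreover have "drop (length u) (take (length (u @ v)) l) = v" by (simp only: L) simp
    ultimately show ?R by (simp add: drop_take)
  qed (simp add: take_add)
  then show "tmul (mono (u @ v)) f l = tmul (mono u) (tmul (mono v) f) l"
    by (simp add: tmul_mono_left add.commute)
qed

lemma tmul_one [simp]: "tmul (mono []) f = f"
  by (simp add: fun_eq_iff tmul_mono_left)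

lemma lie_rel_eq: "lie_rel x y = mono [x, y] - mono [y, x] - comm x y (\<lambda>g. mono [g])"
proof
  fix l
  have "bsum x y (\<lambda>g. mono [g] l) = (case l of [g] \<Rightarrow> brk x y g | _ \<Rightarrow> 0)"
  proof (cases "\<exists>h. l = [h]")
    case True
    then obtain h where "l = [h]" by blast
    then show ?thesis
      by (simp add: mono_apply bsum_def if_distrib [of "(*) _"] cong: if_cong)
  next
    case False
    then show ?thesis
      by (auto simp: mono_apply bsum_def split: list.split intro!: sum.neutral)
  qed
  then show "lie_rel x y l = (mono [x, y] - mono [y, x] - comm x y (\<lambda>g. mono [g])) l"
    by (simp add: lie_rel_def comm_apply)
qed

lemma whit_eq: "whit \<phi> g = mono [g] - scl (\<phi> g) (mono [])"
  by (simp add: whit_def fun_eq_iff)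

definition swap_rel :: "gen list \<Rightarrow> gen \<Rightarrow> gen \<Rightarrow> gen list \<Rightarrow> tens" where
  "swap_rel u x y v = mono (u @ x # y # v) - mono (u @ y # x # v) - comm x y (\<lambda>g. mono (u @ g # v))"

definition whit_rel :: "(gen \<Rightarrow> complex) \<Rightarrow> gen list \<Rightarrow> gen \<Rightarrow> tens" where
  "whit_rel \<phi> u g = mono (u @ [g]) - scl (\<phi> g) (mono u)"

lemma swap_rel_eq: "tmul (mono u) (tmul (lie_rel x y) (mono v)) = swap_rel u x y v"
  by (simp add: lie_rel_eq swap_rel_def tmul_linear tmul_comm_left tmul_comm_right)

lemma whit_rel_eq: "tmul (mono u) (whit \<phi> g) = whit_rel \<phi> u g"
  by (simp add: whit_eq whit_rel_def tmul_linear)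

lemma Kid_subspace: "T.subspace (Kid m \<phi>)"
proof (rule T.subspaceI)
  show "0 \<in> Kid m \<phi>" using Kid.zero by (simp add: zero_fun_def)
next
  fix f h assume "f \<in> Kid m \<phi>" "h \<in> Kid m \<phi>"
  then show "f + h \<in> Kid m \<phi>" using Kid.add by (simp add: plus_fun_def)
next
  fix c f assume "f \<in> Kid m \<phi>"
  then show "scl c f \<in> Kid m \<phi>" using Kid.smult by (simp add: scl_def)
qed

lemma Kid_swap: "swap_rel u x y v \<in> Kid m \<phi>"
  using Kid.rel by (simp add: swap_rel_eq)

lemma Kid_whit: "g \<in> bgen m \<Longrightarrow> whit_rel \<phi> u g \<in> Kid m \<phi>"
  using Kid.wh by (metis whit_rel_eq)

text \<open>\<open>Kid\<close> is the smallest subspace containing both families of relations, so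
  stability and vanishing statements need testing on these words only.\<close>

lemma Kid_least:
  assumes S: "T.subspace S" and "\<And>u x y v. swap_rel u x y v \<in> S"
    and "\<And>u g. g \<in> bgen m \<Longrightarrow> whit_rel \<phi> u g \<in> S"
  shows "Kid m \<phi> \<subseteq> S"
proof
  fix f assume "f \<in> Kid m \<phi>"
  then show "f \<in> S"
  proof induction
    case zero
    then show ?case using T.subspace_0 [OF S] by (simp add: zero_fun_def)
  next
    case (add f h)
    then show ?case using T.subspace_add [OF S] by (fastforce simp: plus_fun_def)
  next
    case (smult f c)
    then show ?case using T.subspace_scale [OF S, of f c] by (simp add: scl_def)
  qed (use assms in \<open>simp_all add: swap_rel_eq whit_rel_eq\<close>)
qed

lemma comm_in: "T.subspace S \<Longrightarrow> (\<And>g. brk x y g \<noteq> 0 \<Longrightarrow> F g \<in> S) \<Longrightarrow> comm x y F \<in> S"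
  unfolding comm_def by (rule T.subspace_sum) (auto intro: T.subspace_scale)

lemma Kid_fsupp: "Kid m \<phi> \<subseteq> fsupp"
  by (rule Kid_least [OF fsupp_subspace])
    (auto simp: swap_rel_def whit_rel_def
      intro!: T.subspace_diff [OF fsupp_subspace] T.subspace_scale [OF fsupp_subspace] comm_in [OF fsupp_subspace])

lemma Kid_left: "f \<in> Kid m \<phi> \<Longrightarrow> tmul (mono w) f \<in> Kid m \<phi>"
proof -
  have "T.subspace {f. tmul (mono w) f \<in> Kid m \<phi>}"
    by (rule T.subspaceI)
      (auto simp: tmul_linear intro: T.subspace_0 T.subspace_add T.subspace_scale Kid_subspace)
  then have "Kid m \<phi> \<subseteq> {f. tmul (mono w) f \<in> Kid m \<phi>}"
  proof (rule Kid_least)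
    fix u x y v
    have "tmul (mono w) (swap_rel u x y v) = swap_rel (w @ u) x y v"
      by (simp add: swap_rel_def tmul_linear tmul_comm_right)
    then show "swap_rel u x y v \<in> {f. tmul (mono w) f \<in> Kid m \<phi>}"
      by (simp add: Kid_swap)
  next
    fix u g assume "g \<in> bgen m"
    moreover have "tmul (mono w) (whit_rel \<phi> u g) = whit_rel \<phi> (w @ u) g"
      by (simp add: whit_rel_def tmul_linear)
    ultimately show "whit_rel \<phi> u g \<in> {f. tmul (mono w) f \<in> Kid m \<phi>}"
      by (simp add: Kid_whit)
  qed
  then show "f \<in> Kid m \<phi> \<Longrightarrow> ?thesis" by auto
qed

text \<open>A vector killed by all \<open>x - \<phi>(x)\<close>, \<open>x\<close> in the subalgebra, gives an endomorphism of the
  module by right multiplication.\<close>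

lemma Kid_right:
  assumes U: "U \<in> fsupp"
    and wh: "\<And>g. g \<in> bgen m \<Longrightarrow> tmul (mono [g]) U - scl (\<phi> g) U \<in> Kid m \<phi>"
    and f: "f \<in> Kid m \<phi>"
  shows "tmul f U \<in> Kid m \<phi>"
proof -
  have "T.subspace {f. tmul f U \<in> Kid m \<phi>}"
    by (rule T.subspaceI)
      (auto simp: tmul_linear intro: T.subspace_0 T.subspace_add T.subspace_scale Kid_subspace)
  then have "Kid m \<phi> \<subseteq> {f. tmul f U \<in> Kid m \<phi>}"
  proof (rule Kid_least)
    fix u x y v
    have "tmul (swap_rel u x y v) (mono w) = swap_rel u x y (v @ w)" for w
      by (simp add: swap_rel_def tmul_linear tmul_comm_left)
    moreover have "tmul (swap_rel u x y v) U =
       (\<Sum>l\<in>{l. U l \<noteq> 0}. scl (U l) (tmul (swap_rel u x y v) (mono l)))"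
      by (subst fsupp_eq_sum [OF U]) (simp add: tmul_linear)
    ultimately show "swap_rel u x y v \<in> {f. tmul f U \<in> Kid m \<phi>}"
      by (auto intro!: T.subspace_sum [OF Kid_subspace] T.subspace_scale [OF Kid_subspace] Kid_swap)
  next
    fix u g assume "g \<in> bgen m"
    moreover have "tmul (whit_rel \<phi> u g) U = tmul (mono u) (tmul (mono [g]) U - scl (\<phi> g) U)"
      by (simp add: whit_rel_def tmul_linear tmul_mono_append)
    ultimately show "whit_rel \<phi> u g \<in> {f. tmul f U \<in> Kid m \<phi>}"
      using wh Kid_left by auto
  qed
  then show ?thesis using f by auto
qed

section \<open>Linear functionals on the tensor algebra and their vanishing on the relations\<close>

definition lext :: "(gen list \<Rightarrow> complex) \<Rightarrow> tens \<Rightarrow> complex" where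
  "lext F f = (\<Sum>l\<in>{l. f l \<noteq> 0}. f l * F l)"

lemma lext_superset: "finite A \<Longrightarrow> {l. f l \<noteq> 0} \<subseteq> A \<Longrightarrow> lext F f = (\<Sum>l\<in>A. f l * F l)"
  unfolding lext_def by (rule sum.mono_neutral_left) auto

lemma lext_add: "f \<in> fsupp \<Longrightarrow> h \<in> fsupp \<Longrightarrow> lext F (f + h) = lext F f + lext F h"
  by (subst (1 2 3) lext_superset [where A = "{l. f l \<noteq> 0} \<union> {l. h l \<noteq> 0}"])
    (auto simp: fsupp_def algebra_simps sum.distrib)

lemma lext_scl: "f \<in> fsupp \<Longrightarrow> lext F (scl c f) = c * lext F f"
  by (subst (1 2) lext_superset [where A = "{l. f l \<noteq> 0}"])
    (auto simp: fsupp_def sum_distrib_left mult.assoc)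

lemma lext_mono [simp]: "lext F (mono u) = F u"
  by (subst lext_superset [where A = "{u}"]) (auto simp: mono_apply)

lemma lext_zero [simp]: "lext F 0 = 0"
  by (simp add: lext_def)

lemma lext_diff: "f \<in> fsupp \<Longrightarrow> h \<in> fsupp \<Longrightarrow> lext F (f - h) = lext F f - lext F h"
  using lext_add [of "f - h" h F] T.subspace_diff [OF fsupp_subspace] by simp

lemma lext_sum: "(\<And>a. a \<in> A \<Longrightarrow> G a \<in> fsupp) \<Longrightarrow> lext F (\<Sum>a\<in>A. G a) = (\<Sum>a\<in>A. lext F (G a))"
  by (induction A rule: infinite_finite_induct)
    (simp_all add: lext_add T.subspace_sum [OF fsupp_subspace])

lemma lext_comm: "(\<And>g. G g \<in> fsupp) \<Longrightarrow> lext F (comm x y G) = bsum x y (\<lambda>g. lext F (G g))"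
  by (simp add: comm_def bsum_def lext_sum lext_scl T.subspace_scale [OF fsupp_subspace])

context whittaker
begin

text \<open>On the two families of relations this is \<open>nf_swap\<close> and
  \<open>nf_snoc\<close>. The functionals thus descend to the module and can detect elements outside
  \<open>Kid\<close>.\<close>

lemma lext_nf_Kid: "f \<in> Kid m \<phi> \<Longrightarrow> lext (nf \<tau>) f = 0"
proof -
  have c: "comm x y (\<lambda>g. mono (u @ g # v)) \<in> fsupp" for x y u v
    by (rule comm_in [OF fsupp_subspace]) simp
  have "Kid m \<phi> \<subseteq> {f \<in> fsupp. lext (nf \<tau>) f = 0}"
  proof (rule Kid_least)
    show "T.subspace {f \<in> fsupp. lext (nf \<tau>) f = 0}"
      using fsupp_subspace by (auto simp: T.subspace_def lext_add lext_scl)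
  next
    fix u x y v
    show "swap_rel u x y v \<in> {f \<in> fsupp. lext (nf \<tau>) f = 0}"
      using nf_swap [of \<tau> u x y v] subsetD [OF Kid_fsupp Kid_swap [of u x y v]]
      by (simp add: c swap_rel_def lext_diff lext_comm T.subspace_diff [OF fsupp_subspace])
  next
    fix u g assume "g \<in> bgen m"
    then show "whit_rel \<phi> u g \<in> {f \<in> fsupp. lext (nf \<tau>) f = 0}"
      using nf_snoc [of g \<tau> u] subsetD [OF Kid_fsupp Kid_whit [of g m \<phi> u]]
      by (simp add: whit_rel_def lext_diff lext_scl T.subspace_scale [OF fsupp_subspace])
  qed
  then show "f \<in> Kid m \<phi> \<Longrightarrow> ?thesis" by auto
qed

lemma one_notin_Kid: "mono [] \<notin> Kid m \<phi>"
proof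
  assume "mono [] \<in> Kid m \<phi>"
  from lext_nf_Kid [OF this, of "lead {#}"] have "nf (lead {#}) [] = 0" by simp
  moreover have "nf (lead {#}) [] = lead {#} []" by (rule nf_lead) simp_all
  ultimately show False by (simp add: lead_def)
qed

end

section \<open>Lowering operators\<close>

lemma tmul_closed_span:
  assumes "\<And>u. u \<in> A \<Longrightarrow> tmul (mono w) (mono u) \<in> T.span B" and "K \<subseteq> T.span B"
    and "\<And>f. f \<in> K \<Longrightarrow> tmul (mono w) f \<in> T.span B" and f: "f \<in> T.span (mono ` A \<union> K)"
  shows "tmul (mono w) f \<in> T.span B"
proof -
  have "T.span (mono ` A \<union> K) \<subseteq> {f. tmul (mono w) f \<in> T.span B}"
  proof (rule T.span_minimal)
    show "T.subspace {f. tmul (mono w) f \<in> T.span B}"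
      by (rule T.subspaceI) (auto simp: tmul_linear T.span_zero T.span_add T.span_scale)
  qed (use assms in auto)
  with f show ?thesis by auto
qed

lemma span_union_monosE:
  assumes "f \<in> T.span (mono ` A \<union> K)" and "T.subspace K"
  obtains h where "h \<in> fsupp_on A" "f - h \<in> K"
proof -
  obtain h k where "h \<in> T.span (mono ` A)" "k \<in> T.span K" "f = h + k"
    using assms(1) unfolding T.span_Un by auto
  with that [of h] assms(2) show thesis by (simp add: span_monos T.span_eq_iff [THEN iffD2])
qed

text \<open>The multiplicity of \<open>i\<close> in \<open>\<mu>\<close> counts the parts of size \<open>i + 1\<close>.\<close>

definition wtm :: "nat multiset \<Rightarrow> nat" where
  "wtm \<mu> = (\<Sum>i\<in>#\<mu>. Suc i)"

lemma wtm_simps [simp]: "wtm {#} = 0" "wtm (add_mset i \<mu>) = Suc i + wtm \<mu>"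
  by (simp_all add: wtm_def)

lemma wtm_eq_0: "wtm \<mu> = 0 \<longleftrightarrow> \<mu> = {#}"
  by (cases \<mu>) auto

lemma wtm_remove: "i \<in># \<mu> \<Longrightarrow> wtm (\<mu> - {#i#}) + Suc i = wtm \<mu>"
  by (metis insert_DiffM wtm_simps(2) add.commute)

text \<open>Modulo terms of lower weight, \<open>X i\<close> is \<open>- c i\<close> times a partial derivative; for \<open>i \<notin># \<mu>\<close>
  the junk word \<open>e (p, \<mu> - {#i#})\<close> has coefficient 0.\<close>

lemma lowering:
  fixes e :: "'p \<times> nat multiset \<Rightarrow> gen list" and X :: "nat \<Rightarrow> tens \<Rightarrow> tens"
  assumes S: "T.subspace S" and K: "T.subspace K" "K \<subseteq> S" and e: "inj e"
    and X_S: "\<And>i f. f \<in> S \<Longrightarrow> X i f \<in> S"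
    and X_add: "\<And>i f h. X i (f + h) = X i f + X i h" and X_scl: "\<And>i c f. X i (scl c f) = scl c (X i f)"
    and c: "\<And>i. c i \<noteq> 0"
    and step: "\<And>i p \<mu>. X i (mono (e (p, \<mu>))) + scl (c i * of_nat (count \<mu> i)) (mono (e (p, \<mu> - {#i#})))
       \<in> T.span (mono ` {e (q, \<nu>) | q \<nu>. wtm \<nu> + i + 2 \<le> wtm \<mu>} \<union> K)"
    and base: "\<And>f. f \<in> S \<Longrightarrow> f \<in> fsupp_on {e (p, {#}) | p. True} \<Longrightarrow> f = 0"
  shows "f \<in> S \<Longrightarrow> f \<in> fsupp_on (range e) \<Longrightarrow> f = 0"
proof -
  have X_sum: "X i (\<Sum>x\<in>A. F x) = (\<Sum>x\<in>A. X i (F x))" for i A and F :: "'p \<times> nat multiset \<Rightarrow> tens"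
  proof -
    have "X i 0 = 0" using X_scl [of i 0 0] by simp
    then show ?thesis
      by (induction A rule: infinite_finite_induct) (use X_add in \<open>auto simp del: plus_fun_apply\<close>)
  qed
  have main: "f = 0" if "f \<in> S" "f \<in> fsupp_on {e (p, \<mu>) | p \<mu>. wtm \<mu> \<le> n}" for f n
    using that
  proof (induction n arbitrary: f rule: less_induct)
    case (less n)
    define A where "A = {x. f (e x) \<noteq> 0}"
    have "finite {l. f l \<noteq> 0}" using less.prems(2) by (simp add: fsupp_on_def fsupp_def)
    then have finA: "finite A"
      unfolding A_def using finite_vimageI [OF _ e, of "{l. f l \<noteq> 0}"] by (simp add: vimage_def)
    have wA: "wtm \<mu> \<le> n" if "(p, \<mu>) \<in> A" for p \<mu>
    proof -
      have "f (e (p, \<mu>)) \<noteq> 0" using that by (simp add: A_def)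
      then obtain q \<nu> where "e (p, \<mu>) = e (q, \<nu>)" "wtm \<nu> \<le> n"
        using less.prems(2) unfolding fsupp_on_def by blast
      then show ?thesis using injD [OF e] by blast
    qed
    have f_eq: "f = (\<Sum>x\<in>A. scl (f (e x)) (mono (e x)))"
    proof -
      have "f = (\<Sum>l\<in>e ` A. scl (f l) (mono l))"
        using less.prems(2) by (intro sum_mono_eq) (use finA in \<open>auto simp: A_def fsupp_on_def\<close>)
      then show ?thesis using e by (simp add: sum.reindex inj_on_subset)
    qed
    show ?case
    proof (rule ccontr)
      assume "f \<noteq> 0"
      \<comment> \<open>If no term attained weight \<open>n\<close>, the bound \<open>n - 1\<close>
        would hold and the induction hypothesis would give f = 0.\<close>
      have "\<exists>p \<mu>. (p, \<mu>) \<in> A \<and> wtm \<mu> = n"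
      proof (rule ccontr)
        assume no: "\<not> ?thesis"
        have "A \<noteq> {}" using \<open>f \<noteq> 0\<close> f_eq by auto
        then have "n > 0" using wA no by fastforce
        have "wtm \<mu> \<le> n - 1" if "(p, \<mu>) \<in> A" for p \<mu>
          using wA [OF that] no that by (metis One_nat_def Suc_pred \<open>n > 0\<close> le_neq_implies_less less_Suc_eq_le)
        then have "f \<in> fsupp_on {e (p, \<mu>) | p \<mu>. wtm \<mu> \<le> n - 1}"
          using less.prems(2) by (fastforce simp: A_def fsupp_on_def)
        then show False using less.IH [of "n - 1" f] \<open>n > 0\<close> less.prems(1) \<open>f \<noteq> 0\<close> by auto
      qed
      then obtain p0 \<mu>0 where x0: "(p0, \<mu>0) \<in> A" "wtm \<mu>0 = n" by blast
      show False
      proof (cases "\<mu>0 = {#}")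
        case True
        then have "n = 0" using x0 by simp
        then have "f \<in> fsupp_on {e (p, {#}) | p. True}"
          using less.prems(2) by (simp add: wtm_eq_0 fsupp_on_def)
        with base less.prems(1) \<open>f \<noteq> 0\<close> show False by blast
      next
        case False
        then obtain i where i: "i \<in># \<mu>0" by (meson multiset_nonemptyE)
        have "\<forall>x. \<exists>h. h \<in> fsupp_on {e (q, \<nu>) | q \<nu>. wtm \<nu> + i + 2 \<le> wtm (snd x)} \<and>
           X i (mono (e x)) + scl (c i * of_nat (count (snd x) i)) (mono (e (fst x, snd x - {#i#}))) - h \<in> K"
        proof
          fix x
          show "\<exists>h. h \<in> fsupp_on {e (q, \<nu>) | q \<nu>. wtm \<nu> + i + 2 \<le> wtm (snd x)} \<and>
             X i (mono (e x)) + scl (c i * of_nat (count (snd x) i)) (mono (e (fst x, snd x - {#i#}))) - h \<in> K"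
            using span_union_monosE [OF step [of i "fst x" "snd x"] K(1)] by (simp only: prod.collapse) blast
        qed
        from choice [OF this] obtain h where
          "\<forall>x. h x \<in> fsupp_on {e (q, \<nu>) | q \<nu>. wtm \<nu> + i + 2 \<le> wtm (snd x)} \<and>
           X i (mono (e x)) + scl (c i * of_nat (count (snd x) i)) (mono (e (fst x, snd x - {#i#}))) - h x \<in> K" ..
        then have h: "h x \<in> fsupp_on {e (q, \<nu>) | q \<nu>. wtm \<nu> + i + 2 \<le> wtm (snd x)}"
          and hK: "X i (mono (e x)) + scl (c i * of_nat (count (snd x) i)) (mono (e (fst x, snd x - {#i#}))) - h x \<in> K" for x
          by blast+
        \<comment> \<open>\<open>G x\<close> is \<open>X i\<close> on one word, reduced modulo
          \<open>K\<close> to a combination of words of \<open>e\<close>; \<open>H\<close> is the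
          same for \<open>f\<close>. Since K \<subseteq> S, \<open>H\<close> lies in
          \<open>S\<close>, and its weight is at most n - i - 1, so it vanishes by
          induction.\<close>
        define G where "G x = h x - scl (c i * of_nat (count (snd x) i)) (mono (e (fst x, snd x - {#i#})))" for x
        define H where "H = (\<Sum>x\<in>A. scl (f (e x)) (G x))"
        have "X i (mono (e x)) - G x \<in> K" for x
          using hK [of x] by (simp add: G_def algebra_simps)
        then have "(\<Sum>x\<in>A. scl (f (e x)) (X i (mono (e x)) - G x)) \<in> K"
          by (intro T.subspace_sum [OF K(1)] T.subspace_scale [OF K(1)])
        moreover have "(\<Sum>x\<in>A. scl (f (e x)) (X i (mono (e x)) - G x)) = X i f - H"
          by (subst f_eq) (simp only: H_def X_sum X_scl T.scale_right_diff_distrib sum_subtractf)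
        ultimately have "X i f - H \<in> S" using K(2) by auto
        then have HS: "H \<in> S"
          using T.subspace_diff [OF S X_S [OF less.prems(1)], of "X i f - H" i] by simp
        have n: "n \<ge> Suc i" using wtm_remove [OF i] x0 by linarith
        have sub: "T.subspace (fsupp_on {e (p, \<mu>) | p \<mu>. wtm \<mu> \<le> n - Suc i})"
          by (rule fsupp_on_subspace)
        have Hn: "H \<in> fsupp_on {e (p, \<mu>) | p \<mu>. wtm \<mu> \<le> n - Suc i}"
          unfolding H_def
        proof (intro T.subspace_sum [OF sub] T.subspace_scale [OF sub])
          fix x assume x: "x \<in> A"
          obtain p \<mu> where xe: "x = (p, \<mu>)" by (cases x)
          have 1: "h x \<in> fsupp_on {e (p, \<mu>) | p \<mu>. wtm \<mu> \<le> n - Suc i}"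
            using h [of x] wA [of p \<mu>] x xe by (fastforce simp: fsupp_on_def)
          have 2: "scl (c i * of_nat (count \<mu> i)) (mono (e (p, \<mu> - {#i#}))) \<in> fsupp_on {e (p, \<mu>) | p \<mu>. wtm \<mu> \<le> n - Suc i}"
          proof (cases "i \<in># \<mu>")
            case True
            then have "wtm (\<mu> - {#i#}) \<le> n - Suc i"
              using wtm_remove [OF True] wA [of p \<mu>] x xe by simp
            then have "mono (e (p, \<mu> - {#i#})) \<in> fsupp_on {e (p, \<mu>) | p \<mu>. wtm \<mu> \<le> n - Suc i}"
              unfolding span_monos [symmetric] by (intro T.span_base) blast
            then show ?thesis by (rule T.subspace_scale [OF sub])
          next
            case False
            then have "count \<mu> i = 0" by (simp add: not_in_iff)
            then show ?thesis using T.subspace_0 [OF sub] by simp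
          qed
          show "G x \<in> fsupp_on {e (p, \<mu>) | p \<mu>. wtm \<mu> \<le> n - Suc i}"
            unfolding G_def by (rule T.subspace_diff [OF sub 1]) (use 2 xe in simp)
        qed
        have "H = 0" by (rule less.IH [OF _ HS Hn]) (use n in simp)
        \<comment> \<open>The target word has weight n - i - 1 while the error terms have weight at
          most n - i - 2. Removing \<open>i\<close> is injective on multisets containing
          \<open>i\<close>, so only (p0, \<mu>0) contributes.\<close>
        have "G x (e (p0, \<mu>0 - {#i#})) = (if x = (p0, \<mu>0) then - (c i * of_nat (count \<mu>0 i)) else 0)"
          if x: "x \<in> A" for x
        proof -
          obtain p \<mu> where xe: "x = (p, \<mu>)" by (cases x)
          have "h x (e (p0, \<mu>0 - {#i#})) = 0"
          proof (rule ccontr)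
            assume "h x (e (p0, \<mu>0 - {#i#})) \<noteq> 0"
            then obtain q \<nu> where "e (p0, \<mu>0 - {#i#}) = e (q, \<nu>)" "wtm \<nu> + i + 2 \<le> wtm \<mu>"
              using h [of x] xe unfolding fsupp_on_def by auto
            then have "wtm (\<mu>0 - {#i#}) + i + 2 \<le> wtm \<mu>" using injD [OF e] by blast
            then show False using wtm_remove [OF i] wA [of p \<mu>] x xe x0 by simp
          qed
          moreover have "of_nat (count \<mu> i) * mono (e (p, \<mu> - {#i#})) (e (p0, \<mu>0 - {#i#})) =
              (if (p, \<mu>) = (p0, \<mu>0) then of_nat (count \<mu>0 i) else (0::complex))"
          proof (cases "i \<in># \<mu>")
            case True
            then have "\<mu> - {#i#} = \<mu>0 - {#i#} \<longleftrightarrow> \<mu> = \<mu>0" using i by (metis insert_DiffM)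
            then show ?thesis using inj_eq [OF e] by (auto simp: mono_apply)
          next
            case False
            then show ?thesis using i by (auto simp: not_in_iff)
          qed
          ultimately show ?thesis by (auto simp: G_def xe mult.assoc)
        qed
        then have "H (e (p0, \<mu>0 - {#i#})) =
          (\<Sum>x\<in>A. if x = (p0, \<mu>0) then f (e x) * - (c i * of_nat (count \<mu>0 i)) else 0)"
          unfolding H_def sum_fun_apply by (intro sum.cong) auto
        also have "\<dots> = f (e (p0, \<mu>0)) * - (c i * of_nat (count \<mu>0 i))"
          using finA x0 by simp
        also have "\<dots> \<noteq> 0" using c i x0 by (simp add: A_def)
        finally show False using \<open>H = 0\<close> by simp
      qed
    qed
  qed
  assume f: "f \<in> S" "f \<in> fsupp_on (range e)"
  have fin: "finite ((snd \<circ> inv e) ` {l. f l \<noteq> 0})"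
    using f by (simp add: fsupp_on_def fsupp_def)
  have "f \<in> fsupp_on {e (p, \<mu>) | p \<mu>. wtm \<mu> \<le> Max (wtm ` (snd \<circ> inv e) ` {l. f l \<noteq> 0})}"
    unfolding fsupp_on_def
  proof (intro CollectI conjI allI impI)
    fix l assume l: "f l \<noteq> 0"
    then obtain p \<mu> where pm: "l = e (p, \<mu>)" using f by (force simp: fsupp_on_def)
    then have "\<mu> = (snd \<circ> inv e) l" using e by simp
    then have "wtm \<mu> \<le> Max (wtm ` (snd \<circ> inv e) ` {l. f l \<noteq> 0})"
      using fin l by (intro Max_ge) auto
    then show "\<exists>p \<mu>. l = e (p, \<mu>) \<and> wtm \<mu> \<le> Max (wtm ` (snd \<circ> inv e) ` {l. f l \<noteq> 0})"
      using pm by blast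
  qed (use f in \<open>simp add: fsupp_on_def\<close>)
  then show "f = 0" by (rule main [OF f(1)])
qed

section \<open>Normal words span the module\<close>

declare plus_fun_apply [simp del] minus_apply [simp del] zero_fun_apply [simp del]
  uminus_apply [simp del] scl_apply [simp del]

lemmas pointwise = plus_fun_apply minus_apply zero_fun_apply uminus_apply scl_apply

lemma comm_DI: "comm (D n) (I k) F =
    scl (of_int k) (F (I (k + n))) + (if n = - k then scl (of_int (n ^ 2 + n)) (F Z2) else 0)"
  by (auto simp: fun_eq_iff pointwise comm_apply bsum_DI)

lemma comm_ID: "comm (I k) (D n) F =
    - scl (of_int k) (F (I (k + n))) - (if n = - k then scl (of_int (n ^ 2 + n)) (F Z2) else 0)"
  by (auto simp: fun_eq_iff pointwise comm_apply bsum_ID)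

text \<open>Index \<open>i\<close> stands for I_{-(i+1)}, so that its size is the part size counted
  by \<open>wtm\<close>; likewise \<open>Dg i\<close> is d_n with m - n = i + 1.\<close>

definition Ig :: "nat \<Rightarrow> gen" where "Ig i = I (- int i - 1)"

locale whittaker_level_zero = whittaker +
  assumes z3: "\<phi> Z3 = 0"
begin

abbreviation K :: "tens set" where "K \<equiv> Kid m \<phi>"

definition Dg :: "nat \<Rightarrow> gen" where "Dg i = D (m - 1 - int i)"

lemma gen_cases:
  obtains "g \<in> bgen m" | i where "g = Ig i" | i where "g = Dg i"
proof (cases g)
  case (D n)
  show thesis
  proof (cases "n < m")
    case True
    then have "g = Dg (nat (m - 1 - n))" using D by (simp add: Dg_def)
    then show thesis using that by blast
  next
    case False
    then show thesis using that(1) D by (simp add: bgen_iff_pkey pkey_def)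
  qed
next
  case (I n)
  show thesis
  proof (cases "n < 0")
    case True
    then have "g = Ig (nat (- n - 1))" using I by (simp add: Ig_def)
    then show thesis using that by blast
  next
    case False
    then show thesis using that(1) I by (simp add: bgen_iff_pkey pkey_def)
  qed
qed (use that(1) in \<open>simp_all add: bgen_iff_pkey pkey_def\<close>)

text \<open>Up to the nonzero factor k - m, I_k is the bracket of d_m and I_{k-m}, both in the
  subalgebra.\<close>

lemma phi_I: "m < k \<Longrightarrow> \<phi> (I k) = 0"
  using bsum_hom [of "D m" "I (k - m)"] m_pos by (simp add: bsum_DI bgen_iff_pkey pkey_def)

text \<open>Here [d_m, d_{k-m}] has the factor k - 2m. At k = 2m it vanishes, so \<phi>(d_{2m}) is
  not forced to be 0; it reappears in the equations for Whittaker vectors.\<close>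

lemma phi_D: "2 * m < k \<Longrightarrow> \<phi> (D k) = 0"
  using bsum_hom [of "D m" "D (k - m)"] m_pos
  by (simp add: bsum_DD bgen_iff_pkey pkey_def del: of_int_diff)

lemma swap_in: "mono (u @ x # y # v) - mono (u @ y # x # v) - comm x y (\<lambda>g. mono (u @ g # v)) \<in> K"
  using Kid_swap [of u x y v m \<phi>] by (simp add: swap_rel_def)

lemma whit_in: "g \<in> bgen m \<Longrightarrow> mono (u @ [g]) - scl (\<phi> g) (mono u) \<in> K"
  using Kid_whit [of g m \<phi> u] by (simp add: whit_rel_def)

lemma central_in:
  assumes "z \<in> {Z1, Z2, Z3}"
  shows "mono (u @ z # v) - scl (\<phi> z) (mono (u @ v)) \<in> K"
proof (induction v arbitrary: u)
  case Nil
  show ?case using whit_in [of z u] assms by (auto simp: bgen_def)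
next
  case (Cons y v)
  have "comm z y F = 0" for F using assms by (auto simp: fun_eq_iff pointwise comm_apply)
  then have "mono (u @ z # y # v) - mono (u @ y # z # v) \<in> K"
    using swap_in [of u z y v] by simp
  from T.subspace_add [OF Kid_subspace this Cons [of "u @ [y]"]] show ?case by simp
qed

lemma Z3_in: "mono (u @ Z3 # v) \<in> K"
  using central_in [of Z3 u v] z3 by simp

text \<open>Each exchange of \<open>x\<close> with a letter \<open>y\<close> of \<open>a\<close>
  costs words in which the two are contracted to a term of [x, y]; \<open>S\<close> only has to
  absorb these.\<close>

lemma move_in:
  assumes S: "T.subspace S" "K \<subseteq> S"
    and "\<And>a1 y a2 g. a = a1 @ y # a2 \<Longrightarrow> brk x y g \<noteq> 0 \<Longrightarrow> mono (p @ a1 @ g # a2 @ s) \<in> S"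
  shows "mono (p @ x # a @ s) - mono (p @ a @ x # s) \<in> S"
  using assms(3)
proof (induction a arbitrary: p)
  case Nil
  show ?case using T.subspace_0 [OF S(1)] by simp
next
  case (Cons y a)
  have "comm x y (\<lambda>g. mono (p @ g # a @ s)) \<in> S"
    by (rule comm_in [OF S(1)]) (use Cons.prems [of "[]" y a] in simp)
  then have 1: "mono (p @ x # y # a @ s) - mono (p @ y # x # a @ s) \<in> S"
    using T.subspace_add [OF S(1), OF subsetD [OF S(2) swap_in [of p x y "a @ s"]]] by fastforce
  have "mono ((p @ [y]) @ x # a @ s) - mono ((p @ [y]) @ a @ x # s) \<in> S"
    by (rule Cons.IH) (use Cons.prems [of "y # a1" for a1] in simp)
  from T.subspace_add [OF S(1) 1 this [simplified]] show ?case by simp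
qed

text \<open>A permutation is a sequence of moves. The hypothesis on contracted words speaks of
  multisets so that it survives the intermediate reorderings.\<close>

lemma perm_in:
  assumes S: "T.subspace S" "K \<subseteq> S"
    and "\<And>u x y v g. mset (u @ x # y # v) = mset l \<Longrightarrow> brk x y g \<noteq> 0 \<Longrightarrow> mono (p @ u @ g # v @ s) \<in> S"
    and "mset l = mset l'"
  shows "mono (p @ l @ s) - mono (p @ l' @ s) \<in> S"
  using assms(3,4)
proof (induction l arbitrary: p l')
  case Nil
  then show ?case using T.subspace_0 [OF S(1)] by simp
next
  case (Cons x l)
  have "x \<in> set l'" using Cons.prems(2) by (metis list.set_intros(1) set_mset_mset)
  then obtain a b where l': "l' = a @ x # b" by (meson split_list)
  have 1: "mono (p @ x # a @ b @ s) - mono (p @ a @ x # b @ s) \<in> S"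
  proof (rule move_in [OF S])
    fix a1 y a2 g assume "a = a1 @ y # a2" "brk x y g \<noteq> 0"
    then show "mono (p @ a1 @ g # a2 @ b @ s) \<in> S"
      using Cons.prems(1) [of a1 x y "a2 @ b" g] Cons.prems(2) l' by simp
  qed
  have "mono ((p @ [x]) @ l @ s) - mono ((p @ [x]) @ (a @ b) @ s) \<in> S"
  proof (rule Cons.IH)
    fix u x' y v g assume "mset (u @ x' # y # v) = mset l" "brk x' y g \<noteq> 0"
    then show "mono ((p @ [x]) @ u @ g # v @ s) \<in> S"
      using Cons.prems(1) [of "x # u" x' y v g] by simp
  next
    show "mset l = mset (a @ b)" using Cons.prems(2) l' by simp
  qed
  from T.subspace_add [OF S(1) this [simplified] 1] show ?case using l' by simp
qed

section \<open>The weight filtration by the letters d_n with n < m\<close>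

definition wt :: "gen \<Rightarrow> nat" where
  "wt g = (case g of D n \<Rightarrow> nat (m - n) | _ \<Rightarrow> 0)"

definition wl :: "gen list \<Rightarrow> nat" where
  "wl l = sum_list (map wt l)"

lemma wl_simps [simp]: "wl [] = 0" "wl (x # l) = wt x + wl l" "wl (l @ l') = wl l + wl l'"
  by (simp_all add: wl_def)

lemma wl_cong_mset: "mset l = mset l' \<Longrightarrow> wl l = wl l'"
  unfolding wl_def by (metis mset_map sum_mset_sum_list)

lemma wt_Ig [simp]: "wt (Ig i) = 0" and wt_Dg [simp]: "wt (Dg i) = Suc i"
  and wt_I [simp]: "wt (I k) = 0"
  by (simp_all add: wt_def Ig_def Dg_def)

lemma brk_wt: "brk x y g \<noteq> 0 \<Longrightarrow> wt g \<le> wt x + wt y"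
  using m_pos by (cases x; cases y; auto simp: wt_def split: if_splits)

text \<open>Before truncation at 0, the weight m - (n + k) of d_{n+k} is smaller than (m - n) + (m -
  k) by m, which is at least 1. This strict drop makes the \<open>D\<close>s commute up to lower
  terms.\<close>

lemma brk_wt_Dg: "brk (Dg i) (Dg j) g \<noteq> 0 \<Longrightarrow> wt g < wt (Dg i) + wt (Dg j)"
  using m_pos by (auto simp: wt_def Dg_def split: if_splits)

text \<open>All \<open>I\<close>s precede all \<open>D\<close>s, whereas the rank interleaves them;
  the orders can coexist because leading coefficients see only the multiset. The \<open>I\<close>s
  in front can be prefixed to computations with \<open>D\<close>-words.\<close>

definition nw :: "nat multiset \<Rightarrow> nat multiset \<Rightarrow> gen list" where
  "nw \<kappa> \<mu> = map Ig (sorted_list_of_multiset \<kappa>) @ map Dg (sorted_list_of_multiset \<mu>)"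

lemma mset_nw: "mset (nw \<kappa> \<mu>) = image_mset Ig \<kappa> + image_mset Dg \<mu>"
  by (simp add: nw_def)

lemma wl_map_Ig [simp]: "wl (map Ig ls) = 0"
  by (induction ls) auto

lemma wl_map_Dg [simp]: "wl (map Dg ls) = wtm (mset ls)"
  by (induction ls) auto

lemma wl_nw [simp]: "wl (nw \<kappa> \<mu>) = wtm \<mu>"
  by (simp add: nw_def)

lemma nw_mset_inject: "mset (nw \<kappa> \<mu>) = mset (nw \<kappa>' \<mu>') \<Longrightarrow> \<kappa> = \<kappa>' \<and> \<mu> = \<mu>'"
proof -
  assume eq: "mset (nw \<kappa> \<mu>) = mset (nw \<kappa>' \<mu>')"
  have "Ig -` {Ig i} = {i}" "Ig -` {Dg i} = {}" "Dg -` {Dg i} = {i}" "Dg -` {Ig i} = {}" for i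
    by (auto simp: Ig_def Dg_def)
  then have "count (mset (nw \<kappa> \<mu>)) (Ig i) = count \<kappa> i" "count (mset (nw \<kappa> \<mu>)) (Dg i) = count \<mu> i" for \<kappa> \<mu> i
    by (auto simp add: mset_nw count_image_mset Int_insert_left not_in_iff)
  with eq show ?thesis by (metis multiset_eqI)
qed

lemma nw_inject: "nw \<kappa> \<mu> = nw \<kappa>' \<mu>' \<longleftrightarrow> \<kappa> = \<kappa>' \<and> \<mu> = \<mu>'"
  using nw_mset_inject by metis

text \<open>Only the \<open>D\<close>-part is bounded; the \<open>I\<close>s are unrestricted
  coefficients. The bound is an integer so that error bounds may become negative, where
  \<open>B t\<close> is just \<open>K\<close>.\<close>

definition B :: "int \<Rightarrow> tens set" where
  "B t = T.span (mono ` {nw \<kappa> \<mu> | \<kappa> \<mu>. int (wtm \<mu>) \<le> t} \<union> K)"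

lemma B_subspace: "T.subspace (B t)"
  by (simp add: B_def)

lemma B_K: "K \<subseteq> B t"
  unfolding B_def using T.span_superset by blast

lemma B_mono: "s \<le> t \<Longrightarrow> B s \<subseteq> B t"
  unfolding B_def by (intro T.span_mono Un_mono image_mono) (auto simp: nw_inject)

lemma B_nw: "int (wtm \<mu>) \<le> t \<Longrightarrow> mono (nw \<kappa> \<mu>) \<in> B t"
  unfolding B_def by (rule T.span_base) blast

lemma normal_mset: "(\<And>g. g \<in> set l \<Longrightarrow> g \<notin> bgen m) \<Longrightarrow> \<exists>\<kappa> \<mu>. mset l = mset (nw \<kappa> \<mu>)"
proof (induction l)
  case Nil
  have "mset [] = mset (nw {#} {#})" by (simp add: mset_nw)
  then show ?case by blast
next
  case (Cons g l)
  then obtain \<kappa> \<mu> where eq: "mset l = mset (nw \<kappa> \<mu>)" by auto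
  show ?case
  proof (cases rule: gen_cases [of g])
    case 1
    with Cons.prems show ?thesis by simp
  next
    case (2 i)
    then have "mset (g # l) = mset (nw (add_mset i \<kappa>) \<mu>)" by (simp add: mset_nw eq)
    then show ?thesis by blast
  next
    case (3 i)
    then have "mset (g # l) = mset (nw \<kappa> (add_mset i \<mu>))" by (simp add: mset_nw eq)
    then show ?thesis by blast
  qed
qed

text \<open>Reordering costs shorter words of no larger weight. A letter of the subalgebra is
  brought to the end and evaluated; with none left, the word is a permutation of a normal
  word.\<close>

lemma mono_B: "int (wl l) \<le> t \<Longrightarrow> mono l \<in> B t"
proof (induction "length l" arbitrary: l t rule: less_induct)
  case less
  have perm: "mono l - mono l' \<in> B t" if "mset l = mset l'" for l'
  proof -
    have "mono ([] @ l @ []) - mono ([] @ l' @ []) \<in> B t"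
    proof (rule perm_in [OF B_subspace B_K _ that])
      fix u x y v g assume uv: "mset (u @ x # y # v) = mset l" "brk x y g \<noteq> 0"
      show "mono ([] @ u @ g # v @ []) \<in> B t"
      proof (rule less.hyps)
        show "length ([] @ u @ g # v @ []) < length l"
          using arg_cong [OF uv(1), of size] by simp
        have "wl l = wl (u @ x # y # v)" using uv(1) by (metis wl_cong_mset)
        then show "int (wl ([] @ u @ g # v @ [])) \<le> t"
          using brk_wt [OF uv(2)] less.prems by simp
      qed
    qed
    then show ?thesis by simp
  qed
  show ?case
  proof (cases "\<exists>g\<in>set l. g \<in> bgen m")
    case True
    then obtain g a b where g: "l = a @ g # b" "g \<in> bgen m" by (meson split_list)
    have "mono (a @ b) \<in> B t" by (rule less.hyps) (use g less.prems in auto)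
    then have "scl (\<phi> g) (mono (a @ b)) \<in> B t" by (rule T.subspace_scale [OF B_subspace])
    from T.subspace_add [OF B_subspace this subsetD [OF B_K whit_in [OF g(2), of "a @ b"]]]
    have "mono ((a @ b) @ [g]) \<in> B t" by simp
    from T.subspace_add [OF B_subspace this perm [of "(a @ b) @ [g]"]] g show ?thesis by simp
  next
    case False
    then obtain \<kappa> \<mu> where eq: "mset l = mset (nw \<kappa> \<mu>)" using normal_mset by blast
    then have "int (wtm \<mu>) \<le> t" using less.prems wl_cong_mset [OF eq] by simp
    from T.subspace_add [OF B_subspace B_nw [OF this, of \<kappa>] perm [OF eq]] show ?thesis by simp
  qed
qed

lemma B_left:
  assumes "f \<in> B t" shows "tmul (mono w) f \<in> B (t + int (wl w))"
proof -
  have "tmul (mono w) f \<in> T.span (B (t + int (wl w)))"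
  proof (rule tmul_closed_span)
    show "f \<in> T.span (mono ` {nw \<kappa> \<mu> | \<kappa> \<mu>. int (wtm \<mu>) \<le> t} \<union> K)"
      using assms by (simp only: B_def)
  next
    fix u assume "u \<in> {nw \<kappa> \<mu> | \<kappa> \<mu>. int (wtm \<mu>) \<le> t}"
    then have "mono (w @ u) \<in> B (t + int (wl w))" by (intro mono_B) auto
    then show "tmul (mono w) (mono u) \<in> T.span (B (t + int (wl w)))"
      by (simp add: T.span_base)
  next
    show "K \<subseteq> T.span (B (t + int (wl w)))" using B_K T.span_superset by blast
  next
    fix f assume "f \<in> K"
    then show "tmul (mono w) f \<in> T.span (B (t + int (wl w)))"
      using Kid_left B_K T.span_base by blast
  qed
  then show ?thesis by (simp add: T.span_eq_iff [THEN iffD2, OF B_subspace])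
qed

lemma D_perm: "mono (map Dg ls) - mono (nw {#} (mset ls)) \<in> B (int (wtm (mset ls)) - 1)"
proof -
  have "mono ([] @ map Dg ls @ []) - mono ([] @ nw {#} (mset ls) @ []) \<in> B (int (wtm (mset ls)) - 1)"
  proof (rule perm_in [OF B_subspace B_K])
    fix u x y v g assume uv: "mset (u @ x # y # v) = mset (map Dg ls)" "brk x y g \<noteq> 0"
    have "set (u @ x # y # v) = set (map Dg ls)" using uv(1) by (rule mset_eq_setD)
    then have "x \<in> Dg ` set ls" "y \<in> Dg ` set ls" by auto
    then obtain i j where "x = Dg i" "y = Dg j" by blast
    then have "wt g < wt x + wt y" using brk_wt_Dg uv(2) by blast
    moreover have "wl (u @ x # y # v) = wtm (mset ls)"
      using wl_cong_mset [OF uv(1)] by simp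
    ultimately show "mono ([] @ u @ g # v @ []) \<in> B (int (wtm (mset ls)) - 1)"
      by (intro mono_B) simp
  qed (simp add: mset_nw)
  then show ?thesis by simp
qed

end

section \<open>The lowering action of the subalgebra\<close>

context whittaker_level_zero
begin

text \<open>Passing I_{i+1} over the first letter \<open>Dg j\<close> yields -(i+1) I_{m+i-j} and
  possibly a central term. For j = i this is I_m, the source of the derivative; for j < i the index
  exceeds m and \<phi> vanishes; for j > i the loss of \<open>Dg j\<close> already lowers the weight
  enough.\<close>

lemma I_lower_D:
  "mono (I (int i + 1) # map Dg ls) - scl (\<phi> (I (int i + 1))) (mono (map Dg ls))
   + scl (of_nat (Suc i) * \<phi> (I m) * of_nat (count (mset ls) i)) (mono (nw {#} (mset ls - {#i#})))
   \<in> B (int (wtm (mset ls)) - int i - 2)"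
proof (induction ls arbitrary: i)
  case Nil
  have "I (int i + 1) \<in> bgen m" by (simp add: bgen_iff_pkey pkey_def)
  then show ?case using whit_in [of "I (int i + 1)" "[]"] B_K by auto
next
  case (Cons j ls)
  define k where "k = int i + 1"
  define n where "n = m - 1 - int j"
  define W where "W = int (wtm (mset ls))"
  \<comment> \<open>The claimed error bound for \<open>j # ls\<close>, whose weight is W + j +
    1.\<close>
  define t where "t = W + int j - int i - 1"
  define q :: complex where "q = (if n = - k then of_int (n ^ 2 + n) else 0)"
  define a where "a = \<phi> (I m)"
  define c where "c = (of_nat (count (mset ls) i) :: complex)"
  define Y where "Y = nw {#} (add_mset j (mset ls) - {#i#})"
  note B_rules = T.subspace_add [OF B_subspace] T.subspace_diff [OF B_subspace] T.subspace_scale [OF B_subspace]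
  \<comment> \<open>With one unit less of precision, I_{i'+1} acts as a scalar. It is needed at the
    index m + i - j of the new letter, which is why \<open>i\<close> is arbitrary in the
    induction.\<close>
  have coarse: "mono (I (int i' + 1) # map Dg ls) - scl (\<phi> (I (int i' + 1))) (mono (map Dg ls))
      \<in> B (W - int i' - 1)" for i'
  proof -
    have "scl (of_nat (Suc i') * a * of_nat (count (mset ls) i')) (mono (nw {#} (mset ls - {#i'#}))) \<in> B (W - int i' - 1)"
    proof (cases "i' \<in># mset ls")
      case True
      then have "int (wtm (mset ls - {#i'#})) \<le> W - int i' - 1"
        using wtm_remove [OF True] by (simp add: W_def)
      then show ?thesis by (intro B_rules B_nw)
    next
      case False
      then have "count (mset ls) i' = 0" by (simp only: not_in_iff)
      then show ?thesis
        using T.subspace_0 [OF B_subspace] by (simp only: of_nat_0 mult_zero_right T.scale_zero_left)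
    qed
    moreover have "mono (I (int i' + 1) # map Dg ls) - scl (\<phi> (I (int i' + 1))) (mono (map Dg ls))
      + scl (of_nat (Suc i') * a * of_nat (count (mset ls) i')) (mono (nw {#} (mset ls - {#i'#}))) \<in> B (W - int i' - 1)"
      using Cons.IH [of i'] B_mono [of "W - int i' - 2" "W - int i' - 1"] by (auto simp: a_def W_def)
    ultimately show ?thesis using B_rules(2) by fastforce
  qed
  have R: "mono (I k # Dg j # map Dg ls) - mono (Dg j # I k # map Dg ls)
      + scl (of_int k) (mono (I (k + n) # map Dg ls)) + scl q (mono (Z2 # map Dg ls)) \<in> B t"
    using subsetD [OF B_K swap_in [of "[]" "I k" "Dg j" "map Dg ls"]]
    by (auto simp: Dg_def comm_ID q_def n_def algebra_simps split: if_splits)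
  have L: "mono (Dg j # I k # map Dg ls) - scl (\<phi> (I k)) (mono (Dg j # map Dg ls))
      + scl (of_nat (Suc i) * a * c) (mono (Dg j # nw {#} (mset ls - {#i#}))) \<in> B t"
    using B_left [OF Cons.IH [of i], of "[Dg j]"]
    by (simp add: tmul_linear k_def a_def c_def t_def W_def algebra_simps)
  have T1: "mono (I (k + n) # map Dg ls) - scl (if j = i then a else 0) (mono (nw {#} (mset ls))) \<in> B t"
  proof -
    consider "j = i" | "j < i" | "i < j" by linarith
    then show ?thesis
    proof cases
      case 1
      have e: "int (nat (m - 1)) + 1 = k + n" "k + n = m" using m_pos 1 by (simp_all add: k_def n_def)
      have 2: "mono (I (k + n) # map Dg ls) - scl a (mono (map Dg ls)) \<in> B t"
        using coarse [of "nat (m - 1)"] B_mono [of "W - int (nat (m - 1)) - 1" t] m_pos 1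
        unfolding e a_def by (auto simp: e t_def)
      have "scl a (mono (map Dg ls) - mono (nw {#} (mset ls))) \<in> B t"
        using D_perm [of ls] 1 by (intro B_rules(3)) (simp add: t_def W_def)
      from B_rules(1) [OF 2 this] show ?thesis using 1 by (simp add: T.scale_right_diff_distrib)
    next
      case 2
      have e: "int (nat (k + n - 1)) + 1 = k + n" and kn: "m < k + n"
        using m_pos 2 by (simp_all add: k_def n_def)
      then have "B (W - int (nat (k + n - 1)) - 1) \<subseteq> B t"
        using m_pos by (intro B_mono) (simp add: t_def k_def n_def)
      then show ?thesis
        using coarse [of "nat (k + n - 1)"] 2 phi_I [OF kn] unfolding e by auto
    next
      case 3
      then have "mono (I (k + n) # map Dg ls) \<in> B t"
        by (intro mono_B) (simp add: t_def W_def)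
      with 3 show ?thesis by simp
    qed
  qed
  have T2: "scl c (mono (Dg j # nw {#} (mset ls - {#i#})) - mono Y) \<in> B t"
  proof (cases "i \<in># mset ls")
    case True
    let ?l = "sorted_list_of_multiset (mset ls - {#i#})"
    have "Y = nw {#} (mset (j # ?l))" using True by (simp add: Y_def)
    moreover have "Dg j # nw {#} (mset ls - {#i#}) = map Dg (j # ?l)" by (simp add: nw_def)
    moreover have "int (wtm (mset (j # ?l))) - 1 = t"
      using wtm_remove [OF True] by (simp add: t_def W_def)
    ultimately show ?thesis using D_perm [of "j # ?l"] by (intro B_rules(3)) simp
  next
    case False
    then have "c = 0" unfolding c_def by (simp only: not_in_iff of_nat_eq_0_iff)
    then show ?thesis using T.subspace_0 [OF B_subspace] by simp
  qed
  have T3: "scl q (mono (Z2 # map Dg ls)) \<in> B t"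
  proof (cases "n = - k")
    case True
    then have "mono (Z2 # map Dg ls) \<in> B t"
      using m_pos by (intro mono_B) (simp add: t_def W_def k_def n_def wt_def)
    then show ?thesis by (rule B_rules)
  next
    case False
    then show ?thesis using T.subspace_0 [OF B_subspace] by (simp add: q_def)
  qed
  have cnt: "of_nat (count (mset (j # ls)) i) = (if j = i then c + 1 else c)"
    by (simp add: c_def)
  have Y': "mono Y = mono (nw {#} (mset ls))" if "j = i"
    using that by (simp add: Y_def)
  have k': "of_int k = (of_nat (Suc i) :: complex)" by (simp add: k_def)
  have "mono (I k # Dg j # map Dg ls) - scl (\<phi> (I k)) (mono (Dg j # map Dg ls))
     + scl (of_nat (Suc i) * a * of_nat (count (mset (j # ls)) i)) (mono Y) =
    (mono (I k # Dg j # map Dg ls) - mono (Dg j # I k # map Dg ls)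
      + scl (of_int k) (mono (I (k + n) # map Dg ls)) + scl q (mono (Z2 # map Dg ls)))
    + (mono (Dg j # I k # map Dg ls) - scl (\<phi> (I k)) (mono (Dg j # map Dg ls))
      + scl (of_nat (Suc i) * a * c) (mono (Dg j # nw {#} (mset ls - {#i#}))))
    - scl (of_nat (Suc i)) (mono (I (k + n) # map Dg ls) - scl (if j = i then a else 0) (mono (nw {#} (mset ls))))
    - scl (of_nat (Suc i) * a) (scl c (mono (Dg j # nw {#} (mset ls - {#i#})) - mono Y))
    - scl q (mono (Z2 # map Dg ls))"
    unfolding cnt k'
    by (cases "j = i") (simp_all add: Y' fun_eq_iff pointwise algebra_simps del: of_nat_Suc)
  also have "\<dots> \<in> B t"
    by (intro B_rules R L T1 T2 T3)
  finally show ?case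
    by (simp add: k_def a_def Y_def t_def W_def algebra_simps)
qed

lemma brk_Ig: "brk (I k) (Ig i) g \<noteq> 0 \<Longrightarrow> g = Z3"
  unfolding Ig_def by (rule brk_II)

lemma I_move: "mono (x # map Ig ls @ s) - mono (map Ig ls @ x # s) \<in> K" if "x = I k" for x
proof -
  have "mono ([] @ x # map Ig ls @ s) - mono ([] @ map Ig ls @ x # s) \<in> K"
  proof (rule move_in [OF Kid_subspace order_refl])
    fix a1 y a2 g assume "map Ig ls = a1 @ y # a2" "brk x y g \<noteq> 0"
    then have "y \<in> Ig ` set ls" by (metis in_set_conv_decomp set_map)
    then have "g = Z3" using \<open>brk x y g \<noteq> 0\<close> that brk_Ig by blast
    then show "mono ([] @ a1 @ g # a2 @ s) \<in> K" using Z3_in [of a1 "a2 @ s"] by simp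
  qed
  then show ?thesis by simp
qed

text \<open>The leading letters I_{-j} commute with I_{i+1} modulo \<open>K\<close> and have weight
  0, so the computation on the \<open>D\<close>-part carries over.\<close>

lemma I_lower:
  "mono (I (int i + 1) # nw \<kappa> \<mu>) - scl (\<phi> (I (int i + 1))) (mono (nw \<kappa> \<mu>))
   + scl (of_nat (Suc i) * \<phi> (I m) * of_nat (count \<mu> i)) (mono (nw \<kappa> (\<mu> - {#i#})))
   \<in> B (int (wtm \<mu>) - int i - 2)"
proof -
  let ?k = "sorted_list_of_multiset \<kappa>" and ?ls = "sorted_list_of_multiset \<mu>"
  have "tmul (mono (map Ig ?k)) (mono (I (int i + 1) # map Dg ?ls) - scl (\<phi> (I (int i + 1))) (mono (map Dg ?ls))
   + scl (of_nat (Suc i) * \<phi> (I m) * of_nat (count \<mu> i)) (mono (nw {#} (\<mu> - {#i#}))))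
   \<in> B (int (wtm \<mu>) - int i - 2)"
    using B_left [OF I_lower_D [of i ?ls], of "map Ig ?k"] by simp
  from T.subspace_add [OF B_subspace this subsetD [OF B_K I_move [OF refl, of "int i + 1" ?k "map Dg ?ls"]]]
  show ?thesis by (simp add: tmul_linear nw_def algebra_simps)
qed

text \<open>The filtration for the second stage: words in the I_{-j} alone, where I_{-j} now has
  weight j instead of 0.\<close>

definition C :: "int \<Rightarrow> tens set" where
  "C t = T.span (mono ` {nw \<kappa> {#} | \<kappa>. int (wtm \<kappa>) \<le> t} \<union> K)"

lemma C_subspace: "T.subspace (C t)"
  by (simp add: C_def)

lemma C_K: "K \<subseteq> C t"
  unfolding C_def using T.span_superset by blast

lemma I_perm: "mono (map Ig ls) - mono (nw (mset ls) {#}) \<in> K"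
proof -
  have "mono ([] @ map Ig ls @ []) - mono ([] @ nw (mset ls) {#} @ []) \<in> K"
  proof (rule perm_in [OF Kid_subspace order_refl])
    fix u x y v g assume uv: "mset (u @ x # y # v) = mset (map Ig ls)" "brk x y g \<noteq> 0"
    have "set (u @ x # y # v) = set (map Ig ls)" using uv(1) by (rule mset_eq_setD)
    then have "x \<in> Ig ` set ls" "y \<in> Ig ` set ls" by auto
    then have "g = Z3" using uv(2) brk_Ig unfolding Ig_def by blast
    then show "mono ([] @ u @ g # v @ []) \<in> K" using Z3_in [of u v] by simp
  qed (simp add: mset_nw)
  then show ?thesis by simp
qed

lemma mono_C: "int (wtm (mset ls)) \<le> t \<Longrightarrow> mono (map Ig ls) \<in> C t"
proof -
  assume "int (wtm (mset ls)) \<le> t"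
  then have "mono (nw (mset ls) {#}) \<in> C t" unfolding C_def by (intro T.span_base) blast
  from T.subspace_add [OF C_subspace this subsetD [OF C_K I_perm [of ls]]] show ?thesis by simp
qed

lemma C_left:
  assumes "f \<in> C t" shows "tmul (mono [Ig j]) f \<in> C (t + int (Suc j))"
proof -
  have "tmul (mono [Ig j]) f \<in> T.span (C (t + int (Suc j)))"
  proof (rule tmul_closed_span)
    show "f \<in> T.span (mono ` {nw \<kappa> {#} | \<kappa>. int (wtm \<kappa>) \<le> t} \<union> K)"
      using assms by (simp only: C_def)
  next
    fix u assume "u \<in> {nw \<kappa> {#} | \<kappa>. int (wtm \<kappa>) \<le> t}"
    then obtain \<kappa> where \<kappa>: "u = nw \<kappa> {#}" "int (wtm \<kappa>) \<le> t" by blast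
    then have "mono (map Ig (j # sorted_list_of_multiset \<kappa>)) \<in> C (t + int (Suc j))"
      by (intro mono_C) simp
    then show "tmul (mono [Ig j]) (mono u) \<in> T.span (C (t + int (Suc j)))"
      by (simp add: T.span_base \<kappa> nw_def)
  next
    show "K \<subseteq> T.span (C (t + int (Suc j)))" using C_K T.span_superset by blast
  next
    fix f assume "f \<in> K"
    then show "tmul (mono [Ig j]) f \<in> T.span (C (t + int (Suc j)))"
      using Kid_left C_K T.span_base by blast
  qed
  then show ?thesis by (simp add: T.span_eq_iff [THEN iffD2, OF C_subspace])
qed

lemma I_scalar: "0 \<le> k \<Longrightarrow> mono (I k # map Ig ls) - scl (\<phi> (I k)) (mono (map Ig ls)) \<in> K"
  using T.subspace_add [OF Kid_subspace I_move [OF refl, of k ls "[]"] whit_in [of "I k" "map Ig ls"]]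
  by (simp add: bgen_iff_pkey pkey_def)

text \<open>Now \<open>Ig j\<close> is passed by d_{m+i+1}, producing -(j+1) I_{m+i-j} and possibly
  a central term. The cases j = i and j < i are as for \<open>I_lower_D\<close>. For j > i a
  nonnegative index is evaluated by \<phi>; a negative one gives a letter of weight j - i - m,
  within the bound since m \<ge> 1.\<close>

lemma D_lower_I:
  "mono (D (m + int i + 1) # map Ig ls) - scl (\<phi> (D (m + int i + 1))) (mono (map Ig ls))
   + scl (of_nat (Suc i) * \<phi> (I m) * of_nat (count (mset ls) i)) (mono (nw (mset ls - {#i#}) {#}))
   \<in> C (int (wtm (mset ls)) - int i - 2)"
proof (induction ls)
  case Nil
  have "D (m + int i + 1) \<in> bgen m" by (simp add: bgen_iff_pkey pkey_def)
  then show ?case using whit_in [of "D (m + int i + 1)" "[]"] C_K by auto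
next
  case (Cons j ls)
  define n where "n = m + int i + 1"
  define W where "W = int (wtm (mset ls))"
  define t where "t = W + int j - int i - 1"
  define q :: complex where "q = (if n = int j + 1 then of_int (n ^ 2 + n) else 0)"
  define a where "a = \<phi> (I m)"
  define c where "c = (of_nat (count (mset ls) i) :: complex)"
  define Y where "Y = nw (add_mset j (mset ls) - {#i#}) {#}"
  note C_rules = T.subspace_add [OF C_subspace] T.subspace_diff [OF C_subspace] T.subspace_scale [OF C_subspace]
  have R: "mono (D n # Ig j # map Ig ls) - mono (Ig j # D n # map Ig ls)
      + scl (of_nat (Suc j)) (mono (I (n - int j - 1) # map Ig ls)) - scl q (mono (Z2 # map Ig ls)) \<in> C t"
    using subsetD [OF C_K swap_in [of "[]" "D n" "Ig j" "map Ig ls"]]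
    by (auto simp: Ig_def comm_DI q_def algebra_simps split: if_splits)
  have L: "mono (Ig j # D n # map Ig ls) - scl (\<phi> (D n)) (mono (Ig j # map Ig ls))
      + scl (of_nat (Suc i) * a * c) (mono (Ig j # nw (mset ls - {#i#}) {#})) \<in> C t"
    using C_left [OF Cons.IH, of j]
    by (simp add: tmul_linear n_def a_def c_def t_def W_def algebra_simps)
  have T1: "mono (I (n - int j - 1) # map Ig ls) - scl (if j = i then a else 0) (mono (nw (mset ls) {#})) \<in> C t"
  proof -
    consider "j = i" | "j < i" | "i < j" "0 \<le> n - int j - 1" | "n - int j - 1 < 0" by linarith
    then show ?thesis
    proof cases
      case 1
      then have e: "n - int j - 1 = m" by (simp add: n_def)
      have "scl a (mono (map Ig ls) - mono (nw (mset ls) {#})) \<in> K"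
        by (intro T.subspace_scale [OF Kid_subspace] I_perm)
      from T.subspace_add [OF Kid_subspace I_scalar [of m ls] this] show ?thesis
        using 1 m_pos C_K e by (auto simp: a_def T.scale_right_diff_distrib)
    next
      case 2
      then show ?thesis
        using I_scalar [of "n - int j - 1" ls] phi_I [of "n - int j - 1"] m_pos C_K by (auto simp: n_def)
    next
      case 3
      then have "mono (map Ig ls) \<in> C t" by (intro mono_C) (simp add: t_def W_def)
      from C_rules(1) [OF subsetD [OF C_K I_scalar [OF 3(2), of ls]]
          C_rules(3) [OF this, where c = "\<phi> (I (n - int j - 1))"]]
      show ?thesis using 3 by simp
    next
      case 4
      then have "I (n - int j - 1) = Ig (nat (int j - n))" by (simp add: Ig_def)
      then have "I (n - int j - 1) # map Ig ls = map Ig (nat (int j - n) # ls)" by simp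
      moreover have "mono (map Ig (nat (int j - n) # ls)) \<in> C t"
        by (rule mono_C) (use 4 m_pos in \<open>simp add: t_def W_def n_def\<close>)
      ultimately show ?thesis using 4 m_pos by (simp add: n_def)
    qed
  qed
  have T2: "scl c (mono (Ig j # nw (mset ls - {#i#}) {#}) - mono Y) \<in> C t"
  proof (cases "i \<in># mset ls")
    case True
    let ?l = "sorted_list_of_multiset (mset ls - {#i#})"
    have "Y = nw (mset (j # ?l)) {#}" using True by (simp add: Y_def)
    moreover have "Ig j # nw (mset ls - {#i#}) {#} = map Ig (j # ?l)" by (simp add: nw_def)
    ultimately show ?thesis using subsetD [OF C_K I_perm [of "j # ?l"]] by (intro C_rules(3)) simp
  next
    case False
    then have "c = 0" unfolding c_def by (simp only: not_in_iff of_nat_eq_0_iff)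
    then show ?thesis using T.subspace_0 [OF C_subspace] by simp
  qed
  have T3: "scl q (mono (Z2 # map Ig ls)) \<in> C t"
  proof (cases "n = int j + 1")
    case True
    then have "mono (map Ig ls) \<in> C t"
      using m_pos by (intro mono_C) (simp add: t_def W_def n_def)
    from C_rules(1) [OF subsetD [OF C_K central_in [of Z2 "[]" "map Ig ls"]]
        C_rules(3) [OF this, where c = "\<phi> Z2"]]
    have "mono (Z2 # map Ig ls) \<in> C t" by simp
    then show ?thesis by (rule C_rules)
  next
    case False
    then show ?thesis using T.subspace_0 [OF C_subspace] by (simp add: q_def)
  qed
  have cnt: "of_nat (count (mset (j # ls)) i) = (if j = i then c + 1 else c)"
    by (simp add: c_def)
  have Y': "mono Y = mono (nw (mset ls) {#})" if "j = i"
    using that by (simp add: Y_def)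
  have "mono (D n # Ig j # map Ig ls) - scl (\<phi> (D n)) (mono (Ig j # map Ig ls))
     + scl (of_nat (Suc i) * a * of_nat (count (mset (j # ls)) i)) (mono Y) =
    (mono (D n # Ig j # map Ig ls) - mono (Ig j # D n # map Ig ls)
      + scl (of_nat (Suc j)) (mono (I (n - int j - 1) # map Ig ls)) - scl q (mono (Z2 # map Ig ls)))
    + (mono (Ig j # D n # map Ig ls) - scl (\<phi> (D n)) (mono (Ig j # map Ig ls))
      + scl (of_nat (Suc i) * a * c) (mono (Ig j # nw (mset ls - {#i#}) {#})))
    - scl (of_nat (Suc j)) (mono (I (n - int j - 1) # map Ig ls) - scl (if j = i then a else 0) (mono (nw (mset ls) {#})))
    - scl (of_nat (Suc i) * a) (scl c (mono (Ig j # nw (mset ls - {#i#}) {#}) - mono Y))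
    + scl q (mono (Z2 # map Ig ls))"
    unfolding cnt
    by (cases "j = i") (simp_all add: Y' fun_eq_iff pointwise algebra_simps del: of_nat_Suc)
  also have "\<dots> \<in> C t"
    by (intro C_rules R L T1 T2 T3)
  finally show ?case
    by (simp add: n_def a_def Y_def t_def W_def algebra_simps)
qed

end

section \<open>Submodules\<close>

context whittaker_level_zero
begin

lemma fsupp_sub_span_normal: "fsupp \<subseteq> T.span (mono ` range (\<lambda>(\<kappa>, \<mu>). nw \<kappa> \<mu>) \<union> K)"
proof -
  have "fsupp_on UNIV \<subseteq> T.span (mono ` range (\<lambda>(\<kappa>, \<mu>). nw \<kappa> \<mu>) \<union> K)"
    unfolding span_monos [symmetric]
  proof (rule T.span_minimal [OF _ T.subspace_span], rule image_subsetI)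
    fix l :: "gen list"
    have "B (int (wl l)) \<subseteq> T.span (mono ` range (\<lambda>(\<kappa>, \<mu>). nw \<kappa> \<mu>) \<union> K)"
      unfolding B_def by (rule T.span_mono) auto
    then show "mono l \<in> T.span (mono ` range (\<lambda>(\<kappa>, \<mu>). nw \<kappa> \<mu>) \<union> K)"
      using mono_B [of l] by blast
  qed
  then show ?thesis by (simp add: fsupp_on_def)
qed

lemma normal_rep:
  assumes "f \<in> fsupp"
  obtains h where "h \<in> fsupp_on (range (\<lambda>(\<kappa>, \<mu>). nw \<kappa> \<mu>))" "f - h \<in> K"
  using span_union_monosE [OF subsetD [OF fsupp_sub_span_normal assms] Kid_subspace] by blast

lemma Kid_neq_fsupp: "K \<noteq> fsupp"
  using one_notin_Kid mono_fsupp by blast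

text \<open>\<open>lowering\<close> is used twice. With the operators I_{i+1} it removes the
  \<open>D\<close>s, the \<open>I\<close>-part being the parameter; its base case is the second use,
  on \<open>I\<close>-words with the operators d_{m+i+1} and a dummy \<open>unit\<close> parameter.
  There the base case is a multiple of the empty word, which is not in \<open>S\<close>.\<close>

lemma submodule_trivial:
  assumes a: "\<phi> (I m) \<noteq> 0" and S: "T.subspace S" and KS: "K \<subseteq> S"
    and left: "\<And>g f. f \<in> S \<Longrightarrow> tmul (mono [g]) f \<in> S" and one: "mono [] \<notin> S"
    and f: "f \<in> S" "f \<in> fsupp"
  shows "f \<in> K"
proof -
  define X where "X g f = tmul (mono [g]) f - scl (\<phi> g) f" for g f
  have X_S: "X g f \<in> S" if "f \<in> S" for g f
    unfolding X_def by (intro T.subspace_diff [OF S] T.subspace_scale [OF S] left that)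
  have X_add: "X g (f + h) = X g f + X g h" and X_scl: "X g (scl c f) = scl c (X g f)" for g f h c
    by (simp_all add: X_def tmul_linear fun_eq_iff pointwise algebra_simps)
  have c: "of_nat (Suc i) * \<phi> (I m) \<noteq> 0" for i
    using a by (simp del: of_nat_Suc)
  have I_part: "h = 0" if "h \<in> S" "h \<in> fsupp_on (range (\<lambda>(u::unit, \<kappa>). nw \<kappa> {#}))" for h
  proof (rule lowering [where X = "\<lambda>i. X (D (m + int i + 1))", OF S Kid_subspace KS _ X_S X_add X_scl c _ _ that])
    show "inj (\<lambda>(u::unit, \<kappa>). nw \<kappa> {#})" by (auto simp: inj_def nw_inject)
  next
    fix i and u :: unit and \<kappa> :: "nat multiset"
    let ?ls = "sorted_list_of_multiset \<kappa>"
    have "{nw \<nu> {#} | \<nu>. int (wtm \<nu>) \<le> int (wtm \<kappa>) - int i - 2} \<subseteq>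
      {(case (q, \<nu>) of (u::unit, \<kappa>) \<Rightarrow> nw \<kappa> {#}) | q \<nu>. wtm \<nu> + i + 2 \<le> wtm \<kappa>}" by force
    then have "C (int (wtm \<kappa>) - int i - 2) \<subseteq>
      T.span (mono ` {(case (q, \<nu>) of (u::unit, \<kappa>) \<Rightarrow> nw \<kappa> {#}) | q \<nu>. wtm \<nu> + i + 2 \<le> wtm \<kappa>} \<union> K)"
      unfolding C_def by (intro T.span_mono Un_mono image_mono) auto
    with D_lower_I [of i ?ls]
    show "X (D (m + int i + 1)) (mono (case (u, \<kappa>) of (u::unit, \<kappa>) \<Rightarrow> nw \<kappa> {#})) +
        scl (of_nat (Suc i) * \<phi> (I m) * of_nat (count \<kappa> i)) (mono (case (u, \<kappa> - {#i#}) of (u::unit, \<kappa>) \<Rightarrow> nw \<kappa> {#}))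
      \<in> T.span (mono ` {(case (q, \<nu>) of (u::unit, \<kappa>) \<Rightarrow> nw \<kappa> {#}) | q \<nu>. wtm \<nu> + i + 2 \<le> wtm \<kappa>} \<union> K)"
      by (auto simp: X_def nw_def)
  next
    fix f assume f: "f \<in> S" "f \<in> fsupp_on {(case (p, {#}) of (u::unit, \<kappa>) \<Rightarrow> nw \<kappa> {#}) | p. True}"
    have "f = scl (f []) (mono [])"
      using sum_mono_eq [of "{[]}" f] f(2) by (auto simp: fsupp_on_def nw_def)
    then show "f = 0"
      using T.subspace_scale [OF S f(1), of "inverse (f [])"] one
      by (metis T.scale_one T.scale_scale T.scale_zero_left left_inverse)
  qed
  have all: "h = 0" if "h \<in> S" "h \<in> fsupp_on (range (\<lambda>(\<kappa>, \<mu>). nw \<kappa> \<mu>))" for h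
  proof (rule lowering [where X = "\<lambda>i. X (I (int i + 1))", OF S Kid_subspace KS _ X_S X_add X_scl c _ _ that])
    show "inj (\<lambda>(\<kappa>, \<mu>). nw \<kappa> \<mu>)" by (auto simp: inj_def nw_inject)
  next
    fix i and \<kappa> \<mu> :: "nat multiset"
    have "{nw \<kappa> \<nu> | \<kappa> \<nu>. int (wtm \<nu>) \<le> int (wtm \<mu>) - int i - 2} \<subseteq>
      {(case (q, \<nu>) of (\<kappa>, \<mu>) \<Rightarrow> nw \<kappa> \<mu>) | q \<nu>. wtm \<nu> + i + 2 \<le> wtm \<mu>}" by force
    then have "B (int (wtm \<mu>) - int i - 2) \<subseteq>
      T.span (mono ` {(case (q, \<nu>) of (\<kappa>, \<mu>) \<Rightarrow> nw \<kappa> \<mu>) | q \<nu>. wtm \<nu> + i + 2 \<le> wtm \<mu>} \<union> K)"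
      unfolding B_def by (intro T.span_mono Un_mono image_mono) auto
    with I_lower [of i \<kappa> \<mu>]
    show "X (I (int i + 1)) (mono (case (\<kappa>, \<mu>) of (\<kappa>, \<mu>) \<Rightarrow> nw \<kappa> \<mu>)) +
        scl (of_nat (Suc i) * \<phi> (I m) * of_nat (count \<mu> i)) (mono (case (\<kappa>, \<mu> - {#i#}) of (\<kappa>, \<mu>) \<Rightarrow> nw \<kappa> \<mu>))
      \<in> T.span (mono ` {(case (q, \<nu>) of (\<kappa>, \<mu>) \<Rightarrow> nw \<kappa> \<mu>) | q \<nu>. wtm \<nu> + i + 2 \<le> wtm \<mu>} \<union> K)"
      by (auto simp: X_def)
  next
    fix f assume f: "f \<in> S" "f \<in> fsupp_on {(case (p, {#}) of (\<kappa>, \<mu>) \<Rightarrow> nw \<kappa> \<mu>) | p. True}"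
    have "{(case (p, {#}) of (\<kappa>, \<mu>) \<Rightarrow> nw \<kappa> \<mu>) | p. True} = range (\<lambda>(u::unit, \<kappa>). nw \<kappa> {#})"
      by auto
    with I_part f show "f = 0" by simp
  qed
  obtain h where h: "h \<in> fsupp_on (range (\<lambda>(\<kappa>, \<mu>). nw \<kappa> \<mu>))" "f - h \<in> K"
    using normal_rep [OF f(2)] .
  have "h \<in> S" using T.subspace_diff [OF S f(1) subsetD [OF KS h(2)]] by simp
  then have "h = 0" using all h(1) by blast
  with h(2) show ?thesis by simp
qed

lemma words_generate:
  assumes S: "T.subspace S" and left: "\<And>g f. f \<in> S \<Longrightarrow> tmul (mono [g]) f \<in> S" and one: "mono [] \<in> S"
  shows "fsupp \<subseteq> S"
proof -
  have "mono l \<in> S" for l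
  proof (induction l)
    case (Cons g l)
    then show ?case using left [of "mono l" g] by simp
  qed (rule one)
  then have "T.span (mono ` UNIV) \<subseteq> S" by (intro T.span_minimal S) auto
  then show ?thesis by (simp add: span_monos fsupp_on_def)
qed

lemma simple_if:
  assumes "\<phi> (I m) \<noteq> 0"
  shows "whittaker_simple m \<phi>"
  unfolding whittaker_simple_def
proof (intro conjI allI impI)
  show "K \<noteq> fsupp" by (rule Kid_neq_fsupp)
next
  fix S
  assume S: "K \<subseteq> S \<and> S \<subseteq> fsupp \<and> (\<forall>f\<in>S. \<forall>h\<in>S. (\<lambda>l. f l + h l) \<in> S)
    \<and> (\<forall>c. \<forall>f\<in>S. (\<lambda>l. c * f l) \<in> S) \<and> (\<forall>g. \<forall>f\<in>S. tmul (mono [g]) f \<in> S)"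
  have sub: "T.subspace S"
  proof (rule T.subspaceI)
    show "0 \<in> S" using S T.subspace_0 [OF Kid_subspace] by blast
  qed (use S in \<open>simp_all add: plus_fun_def scl_def\<close>)
  show "S = K \<or> S = fsupp"
  proof (cases "mono [] \<in> S")
    case True
    then have "fsupp \<subseteq> S" using words_generate [OF sub] S by blast
    then show ?thesis using S by blast
  next
    case False
    then have "S \<subseteq> K" using submodule_trivial [OF assms sub] S by blast
    then show ?thesis using S by blast
  qed
qed

section \<open>The submodule generated by a Whittaker vector\<close>

lemma Ig_notin_bgen: "Ig i \<notin> bgen m" and Dg_notin_bgen: "Dg i \<notin> bgen m"
  by (simp_all add: bgen_iff_pkey pkey_def Ig_def Dg_def)

text \<open>In the associated graded ring, a polynomial ring, the symbol of \<open>U\<close> is, up to a scalar, monic in \<open>g\<close>, so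
  multiplying by it raises the maximal degree in \<open>g\<close> by exactly \<open>r\<close>.\<close>

lemma leading_term:
  assumes U: "U \<in> fsupp" "U (replicate r g) \<noteq> 0" and g: "g \<notin> bgen m"
    and lead: "\<And>t. U t \<noteq> 0 \<Longrightarrow> length t \<le> r \<and> (length t = r \<longrightarrow> t = replicate r g \<or> count (mset t) g < r)"
    and p: "p \<in> fsupp_on (range (\<lambda>(\<kappa>, \<mu>). nw \<kappa> \<mu>))" "p \<noteq> 0"
  obtains M where "r \<le> size M" "lext (nf (lead M)) (tmul p U) \<noteq> 0"
proof -
  define A where "A = {l. p l \<noteq> 0}"
  have finA: "finite A" using p by (simp add: A_def fsupp_on_def fsupp_def)
  have A0: "A \<noteq> {}" using p(2) by (auto simp: A_def fun_eq_iff pointwise)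
  define d where "d = Max (length ` A)"
  define A' where "A' = {l \<in> A. length l = d}"
  have "d \<in> length ` A" unfolding d_def using finA A0 by (intro Max_in) auto
  then have A': "finite A'" "A' \<noteq> {}" using finA by (auto simp: A'_def)
  have "Max ((\<lambda>l. count (mset l) g) ` A') \<in> (\<lambda>l. count (mset l) g) ` A'"
    using A' by (intro Max_in) auto
  \<comment> \<open>Among the longest words of \<open>p\<close>, one with the most letters
    \<open>g\<close>: its product with g^r is the only one that contributes to the multiset
    \<open>M\<close> below.\<close>
  then obtain l0 where l0: "l0 \<in> A'" "count (mset l0) g = Max ((\<lambda>l. count (mset l) g) ` A')" by auto
  have len: "length l \<le> length l0" if "l \<in> A" for l
    using that finA l0(1) by (auto simp: A'_def d_def)
  have cnt: "count (mset l) g \<le> count (mset l0) g" if "l \<in> A" "length l = length l0" for l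
    unfolding l0(2) using that l0(1) A' by (intro Max_ge) (auto simp: A'_def)
  obtain \<kappa>0 \<mu>0 where nw0: "l0 = nw \<kappa>0 \<mu>0"
    using l0(1) p by (auto simp: A'_def A_def fsupp_on_def)
  define M where "M = mset l0 + replicate_mset r g"
  define N where "N = {t. U t \<noteq> 0}"
  have finN: "finite N" using U by (simp add: N_def fsupp_def)
  have M: "h \<notin> bgen m" if "h \<in># M" for h
    using that g nw0 by (auto simp: M_def nw_def Ig_notin_bgen Dg_notin_bgen split: if_splits)
  have sub: "T.subspace fsupp" by (rule fsupp_subspace)
  have "tmul p U = (\<Sum>l\<in>A. scl (p l) (\<Sum>t\<in>N. scl (U t) (mono (l @ t))))"
  proof -
    have p': "p = (\<Sum>l\<in>A. scl (p l) (mono l))"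
      unfolding A_def by (rule fsupp_eq_sum) (use p in \<open>simp add: fsupp_on_def\<close>)
    have U': "U = (\<Sum>t\<in>N. scl (U t) (mono t))"
      unfolding N_def by (rule fsupp_eq_sum [OF U(1)])
    have "tmul (mono l) U = (\<Sum>t\<in>N. scl (U t) (mono (l @ t)))" for l
      using arg_cong [OF U', of "tmul (mono l)"] by (simp only: tmul_sum_right tmul_scl_right tmul_mono_mono)
    then show ?thesis
      using arg_cong [OF p', of "\<lambda>q. tmul q U"] by (simp only: tmul_sum_left tmul_scl_left)
  qed
  then have "lext (nf (lead M)) (tmul p U) = (\<Sum>l\<in>A. \<Sum>t\<in>N. p l * U t * nf (lead M) (l @ t))"
    by (simp add: lext_sum lext_scl T.subspace_sum [OF sub] T.subspace_scale [OF sub] sum_distrib_left mult.assoc)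
  also have "\<dots> = (\<Sum>l\<in>A. \<Sum>t\<in>N. if l = l0 \<and> t = replicate r g then p l * U t else 0)"
  proof (intro sum.cong refl)
    fix l t assume lt: "l \<in> A" "t \<in> N"
    have t: "length t \<le> r" "length t = r \<Longrightarrow> t = replicate r g \<or> count (mset t) g < r"
      using lead [of t] lt by (auto simp: N_def)
    show "p l * U t * nf (lead M) (l @ t) = (if l = l0 \<and> t = replicate r g then p l * U t else 0)"
    proof (cases "length l + length t = length l0 + r")
      case True
      then have eq: "length t = r" "length l = length l0" using t(1) len [OF lt(1)] by auto
      then have nf: "nf (lead M) (l @ t) = lead M (l @ t)" by (intro nf_lead M) (auto simp: M_def)
      show ?thesis
      proof (cases "mset (l @ t) = M")
        case True
        \<comment> \<open>As \<open>l\<close> has no more letters \<open>g\<close> than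
          \<open>l0\<close>, \<open>t\<close> has at least \<open>r\<close> of them, which leaves
          only g^r.\<close>
        then have "count (mset l) g + count (mset t) g = count (mset l0) g + r"
          by (metis M_def count_replicate_mset mset_append plus_multiset.rep_eq)
        then have "t = replicate r g" using cnt [OF lt(1) eq(2)] t(2) [OF eq(1)] by linarith
        moreover from this True have "mset l = mset l0" by (simp add: M_def)
        moreover obtain \<kappa> \<mu> where "l = nw \<kappa> \<mu>"
          using lt(1) p by (auto simp: A_def fsupp_on_def)
        ultimately have "l = l0 \<and> t = replicate r g" using nw_mset_inject nw0 by blast
        then show ?thesis using nf True by (simp add: lead_def)
      next
        case False
        then have "\<not> (l = l0 \<and> t = replicate r g)" by (auto simp: M_def)
        then show ?thesis using nf False by (auto simp: lead_def)
      qed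
    next
      case False
      then have "length (l @ t) < size M" using t(1) len [OF lt(1)] by (simp add: M_def)
      moreover have "\<not> (l = l0 \<and> t = replicate r g)" using False by auto
      ultimately show ?thesis by (auto simp: nf_lead_short)
    qed
  qed
  also have "\<dots> = (\<Sum>l\<in>A. if l = l0 then p l * U (replicate r g) else 0)"
    using finN U(2) by (intro sum.cong) (auto simp: N_def)
  also have "\<dots> = p l0 * U (replicate r g)"
    using finA l0(1) by (simp add: A'_def)
  also have "\<dots> \<noteq> 0" using U(2) l0(1) by (simp add: A'_def A_def)
  finally show thesis by (rule that [rotated]) (simp add: M_def)
qed

text \<open>The submodule \<open>S\<close> generated by \<open>U\<close> is not \<open>K\<close>, by
  leading terms. If it were everything, then 1 = p U modulo \<open>K\<close>. As \<open>U\<close> is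
  a Whittaker vector, \<open>Kid_right\<close> permits replacing \<open>p\<close> by a normal form
  \<open>h\<close>; then h U has a nonzero coefficient at some \<open>M\<close> of size at least r >
  0, a functional that vanishes on 1.\<close>

lemma not_simple_if_whittaker_vector:
  assumes U: "U \<in> fsupp" "U (replicate r g) \<noteq> 0" and g: "g \<notin> bgen m" and r: "0 < r"
    and lead: "\<And>t. U t \<noteq> 0 \<Longrightarrow> length t \<le> r \<and> (length t = r \<longrightarrow> t = replicate r g \<or> count (mset t) g < r)"
    and wh: "\<And>x. x \<in> bgen m \<Longrightarrow> tmul (mono [x]) U - scl (\<phi> x) U \<in> K"
  shows "\<not> whittaker_simple m \<phi>"
proof
  assume simple: "whittaker_simple m \<phi>"
  define S where "S = {f \<in> fsupp. \<exists>p\<in>fsupp. f - tmul p U \<in> K}"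
  have tmul_fsupp: "tmul (mono w) f \<in> fsupp" if "f \<in> fsupp" for w f
  proof -
    have "tmul (mono w) f = (\<Sum>l\<in>{l. f l \<noteq> 0}. scl (f l) (mono (w @ l)))"
      by (subst fsupp_eq_sum [OF that]) (simp add: tmul_linear)
    also have "\<dots> \<in> fsupp"
      by (intro T.subspace_sum T.subspace_scale fsupp_subspace mono_fsupp)
    finally show ?thesis .
  qed
  have KS: "K \<subseteq> S"
  proof
    fix f assume "f \<in> K"
    then have "f \<in> fsupp" "f - tmul 0 U \<in> K" using Kid_fsupp by auto
    then show "f \<in> S" unfolding S_def using T.subspace_0 [OF fsupp_subspace] by blast
  qed
  have "(\<lambda>l. f l + h l) \<in> S" if fh: "f \<in> S" "h \<in> S" for f h
  proof -
    obtain p q where pq: "p \<in> fsupp" "q \<in> fsupp" "f - tmul p U \<in> K" "h - tmul q U \<in> K"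
      using fh unfolding S_def by blast
    have "(f + h) - tmul (p + q) U \<in> K"
      using T.subspace_add [OF Kid_subspace pq(3,4)] by (simp add: tmul_linear algebra_simps)
    then have "f + h \<in> S"
      using fh pq T.subspace_add [OF fsupp_subspace] unfolding S_def by blast
    then show ?thesis by (simp add: plus_fun_def)
  qed
  moreover have "(\<lambda>l. c * f l) \<in> S" if fS: "f \<in> S" for c f
  proof -
    obtain p where p: "p \<in> fsupp" "f - tmul p U \<in> K" using fS by (auto simp: S_def)
    have "scl c f - tmul (scl c p) U \<in> K"
      using T.subspace_scale [OF Kid_subspace p(2), of c] by (simp add: tmul_linear T.scale_right_diff_distrib)
    then have "scl c f \<in> S"
      using fS p T.subspace_scale [OF fsupp_subspace] unfolding S_def by blast
    then show ?thesis by (simp add: scl_def)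
  qed
  moreover have "tmul (mono [x]) f \<in> S" if fS: "f \<in> S" for x f
  proof -
    obtain p where p: "p \<in> fsupp" "f - tmul p U \<in> K" using fS by (auto simp: S_def)
    have assoc: "tmul (tmul (mono [x]) p) U = tmul (mono [x]) (tmul p U)"
    proof -
      have "tmul (tmul (mono [x]) (mono l)) U = tmul (mono [x]) (tmul (mono l) U)" for l
        using tmul_mono_append [of "[x]" l U] by simp
      then have "tmul (tmul (mono [x]) (\<Sum>l\<in>A. scl (p l) (mono l))) U =
          tmul (mono [x]) (tmul (\<Sum>l\<in>A. scl (p l) (mono l)) U)" for A
        by (simp only: tmul_linear)
      then show ?thesis using fsupp_eq_sum [OF p(1)] by metis
    qed
    have "tmul (mono [x]) f - tmul (tmul (mono [x]) p) U \<in> K"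
      using Kid_left [OF p(2), of "[x]"] by (simp add: tmul_linear assoc)
    then show ?thesis using fS p tmul_fsupp unfolding S_def by blast
  qed
  moreover have "S \<subseteq> fsupp" by (auto simp: S_def)
  ultimately have "K \<subseteq> S \<and> S \<subseteq> fsupp \<and> (\<forall>f\<in>S. \<forall>h\<in>S. (\<lambda>l. f l + h l) \<in> S)
    \<and> (\<forall>c. \<forall>f\<in>S. (\<lambda>l. c * f l) \<in> S) \<and> (\<forall>g. \<forall>f\<in>S. tmul (mono [g]) f \<in> S)"
    using KS by blast
  then have cases: "S = K \<or> S = fsupp"
    using simple unfolding whittaker_simple_def by blast
  have nz: "lext (nf (lead M)) f = 0" if "f \<in> K" for f M using that by (rule lext_nf_Kid)
  have "U \<notin> K"
  proof
    assume "U \<in> K"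
    have "[] = (\<lambda>(\<kappa>, \<mu>). nw \<kappa> \<mu>) ({#}, {#})" by (simp add: nw_def)
    then have "[] \<in> range (\<lambda>(\<kappa>, \<mu>). nw \<kappa> \<mu>)" by (rule range_eqI)
    then have "mono [] \<in> fsupp_on (range (\<lambda>(\<kappa>, \<mu>). nw \<kappa> \<mu>))"
      by (auto simp: fsupp_on_def mono_apply split: if_splits)
    moreover have "mono [] \<noteq> 0" by (simp add: mono_apply fun_eq_iff pointwise)
    ultimately obtain M where "lext (nf (lead M)) (tmul (mono []) U) \<noteq> 0"
      using leading_term [OF U g lead] by blast
    with nz \<open>U \<in> K\<close> show False by simp
  qed
  moreover have "U \<in> S"
    using U(1) T.subspace_0 [OF Kid_subspace] by (auto simp: S_def intro!: bexI [of _ "mono []"])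
  ultimately have "mono [] \<in> S" using cases by auto
  then obtain p where p: "p \<in> fsupp" "mono [] - tmul p U \<in> K" by (auto simp: S_def)
  obtain h where h: "h \<in> fsupp_on (range (\<lambda>(\<kappa>, \<mu>). nw \<kappa> \<mu>))" "p - h \<in> K"
    using normal_rep [OF p(1)] .
  have "tmul (p - h) U \<in> K" by (rule Kid_right [OF U(1) wh h(2)])
  from T.subspace_add [OF Kid_subspace p(2) this]
  have hU: "mono [] - tmul h U \<in> K" by (simp add: tmul_linear algebra_simps)
  have "h \<noteq> 0" using hU one_notin_Kid by auto
  then obtain M where M: "r \<le> size M" "lext (nf (lead M)) (tmul h U) \<noteq> 0"
    using leading_term [OF U g lead h(1)] by blast
  have "tmul h U \<in> fsupp"
    using T.subspace_diff [OF fsupp_subspace mono_fsupp [of "[]"] subsetD [OF Kid_fsupp hU]] by simp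
  then have "lext (nf (lead M)) (tmul h U) = nf (lead M) []"
    using nz [OF hU, of M] by (simp add: lext_diff)
  also have "\<dots> = 0" using M(1) r by (intro nf_lead_short) simp
  finally show False using M(2) by simp
qed

end

section \<open>Whittaker vectors for \<open>\<phi>(I\<^sub>m) = 0\<close>\<close>

lemma I_in_bgen: "I k \<in> bgen m \<longleftrightarrow> 0 \<le> k" and D_in_bgen: "D n \<in> bgen m \<longleftrightarrow> m \<le> n"
  and Z_in_bgen: "Z1 \<in> bgen m" "Z2 \<in> bgen m" "Z3 \<in> bgen m"
  by (simp_all add: bgen_iff_pkey pkey_def)

context whittaker_level_zero
begin

text \<open>Whittaker vectors are the common kernel, modulo \<open>K\<close>, of these operators for
  \<open>x\<close> in the subalgebra.\<close>

definition act :: "gen \<Rightarrow> tens \<Rightarrow> tens" where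
  "act x f = tmul (mono [x]) f - scl (\<phi> x) f"

lemma act_sum: "act x (\<Sum>y\<in>A. scl (c y) (F y)) = (\<Sum>y\<in>A. scl (c y) (act x (F y)))"
  by (simp add: act_def tmul_linear T.scale_sum_right sum_subtractf T.scale_right_diff_distrib
      mult.commute)

lemma act_mono:
  assumes "x \<in> bgen m"
  shows "act x (mono [y]) - comm x y (\<lambda>g. mono [g]) \<in> K"
proof -
  have "mono ([] @ x # y # []) - mono ([] @ y # x # []) - comm x y (\<lambda>g. mono ([] @ g # [])) \<in> K"
    by (rule swap_in)
  moreover have "mono ([y] @ [x]) - scl (\<phi> x) (mono [y]) \<in> K" by (rule whit_in [OF assms])
  ultimately have "(mono ([] @ x # y # []) - mono ([] @ y # x # []) - comm x y (\<lambda>g. mono ([] @ g # [])))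
      + (mono ([y] @ [x]) - scl (\<phi> x) (mono [y])) \<in> K"
    by (rule T.subspace_add [OF Kid_subspace])
  then show ?thesis by (simp add: act_def algebra_simps)
qed

lemma comm_diff: "comm x y F - comm x y H = comm x y (\<lambda>g. F g - H g)"
  by (simp add: comm_def T.scale_right_diff_distrib sum_subtractf)

text \<open>On the generator x y = y x + [x, y], and y x gives \<phi>(x) y. If [x, y] is in the
  subalgebra, \<phi> evaluates it, so linear Whittaker vectors are governed by scalar
  equations.\<close>

lemma act_mono_scalar:
  assumes x: "x \<in> bgen m" and "\<And>g. brk x y g \<noteq> 0 \<Longrightarrow> g \<in> bgen m"
  shows "act x (mono [y]) - scl (bsum x y \<phi>) (mono []) \<in> K"
proof -
  have "comm x y (\<lambda>g. mono ([] @ [g]) - scl (\<phi> g) (mono [])) \<in> K"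
    by (rule comm_in [OF Kid_subspace], rule whit_in) (rule assms)
  then have "comm x y (\<lambda>g. mono [g]) - comm x y (\<lambda>g. scl (\<phi> g) (mono [])) \<in> K"
    by (simp only: comm_diff append_Nil)
  moreover have "comm x y (\<lambda>g. scl (\<phi> g) (mono [])) = scl (bsum x y \<phi>) (mono [])"
    by (simp add: fun_eq_iff comm_apply pointwise bsum_mult_right)
  ultimately have "comm x y (\<lambda>g. mono [g]) - scl (bsum x y \<phi>) (mono []) \<in> K"
    by (simp only:)
  from T.subspace_add [OF Kid_subspace act_mono [OF x, of y] this] show ?thesis by simp
qed

text \<open>Letters with coefficient 0 are exempt from the closure condition; this admits I_{-2}
  with \<beta> = 0 when m = 1.\<close>

lemma not_simple_if_linear_vector:
  assumes fin: "finite Y" and y0: "y0 \<in> Y" "c y0 \<noteq> 0" "y0 \<notin> bgen m"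
    and closed: "\<And>x y g. x \<in> bgen m \<Longrightarrow> y \<in> Y \<Longrightarrow> c y \<noteq> 0 \<Longrightarrow> brk x y g \<noteq> 0 \<Longrightarrow> g \<in> bgen m"
    and zero: "\<And>x. x \<in> bgen m \<Longrightarrow> (\<Sum>y\<in>Y. c y * bsum x y \<phi>) = 0"
  shows "\<not> whittaker_simple m \<phi>"
proof (rule not_simple_if_whittaker_vector)
  define U where "U = (\<Sum>y\<in>Y. scl (c y) (mono [y]))"
  have U: "U t = (case t of [y] \<Rightarrow> (if y \<in> Y then c y else 0) | _ \<Rightarrow> 0)" for t
    using fin
    by (auto simp: U_def sum_fun_apply pointwise mono_apply if_distrib [of "(*) _"] split: list.split cong: if_cong)
  show "U \<in> fsupp"
    unfolding U_def by (intro T.subspace_sum T.subspace_scale fsupp_subspace mono_fsupp)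
  show "U (replicate 1 y0) \<noteq> 0" using y0 by (simp add: U)
  show "y0 \<notin> bgen m" "0 < (1::nat)" using y0 by simp_all
  show "length t \<le> 1 \<and> (length t = 1 \<longrightarrow> t = replicate 1 y0 \<or> count (mset t) y0 < 1)" if "U t \<noteq> 0" for t
    using that by (auto simp: U split: list.splits)
  fix x assume x: "x \<in> bgen m"
  have "scl (c y) (act x (mono [y]) - scl (bsum x y \<phi>) (mono [])) \<in> K" if "y \<in> Y" for y
  proof (cases "c y = 0")
    case True
    then show ?thesis using T.subspace_0 [OF Kid_subspace] by simp
  next
    case False
    then show ?thesis
      by (intro T.subspace_scale [OF Kid_subspace] act_mono_scalar x closed [OF x that]) simp_all
  qed
  then have "(\<Sum>y\<in>Y. scl (c y) (act x (mono [y]) - scl (bsum x y \<phi>) (mono []))) \<in> K"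
    by (intro T.subspace_sum [OF Kid_subspace])
  also have "(\<Sum>y\<in>Y. scl (c y) (act x (mono [y]) - scl (bsum x y \<phi>) (mono []))) =
      act x U - scl (\<Sum>y\<in>Y. c y * bsum x y \<phi>) (mono [])"
    by (simp add: U_def act_sum T.scale_right_diff_distrib sum_subtractf T.scale_sum_left)
  finally show "tmul (mono [x]) U - scl (\<phi> x) U \<in> K" using zero [OF x] by (simp add: act_def)
qed

section \<open>Values of \<phi> on brackets with d_{m-1}, I_{-1} and I_{-2}\<close>

lemma bgen_cases:
  assumes "x \<in> bgen m"
  obtains k where "x = I k" "0 \<le> k" | n where "x = D n" "m \<le> n" | "x \<in> {Z1, Z2, Z3}"
  using assms by (cases x) (auto simp: bgen_iff_pkey pkey_def split: if_splits)

lemma brk_in_bgen: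
  assumes "x \<in> bgen m" "brk x y g \<noteq> 0"
  shows "y = D (m - 1) \<Longrightarrow> g \<in> bgen m" "y = I (-1) \<Longrightarrow> g \<in> bgen m"
    "y = I (-2) \<Longrightarrow> m \<noteq> 1 \<or> x \<noteq> D 1 \<Longrightarrow> g \<in> bgen m"
  using assms m_pos
  by (auto elim!: bgen_cases simp: I_in_bgen D_in_bgen Z_in_bgen split: if_splits)

lemma bsum_I_neg: "bsum (I k) (I j) \<phi> = 0"
  by (simp add: bsum_II z3)

text \<open>The value is -k \<phi>(I_{k+m-1}): the factor is 0 for k = 0, the hypothesis applies for
  k = 1, and the index exceeds m for larger k. A central term can arise only for m = 1, k = 0, where
  its coefficient is 0.\<close>

lemma bsum_I_D:
  assumes "\<phi> (I m) = 0" "0 \<le> k"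
  shows "bsum (I k) (D (m - 1)) \<phi> = 0"
proof -
  have "of_int k * \<phi> (I (k + (m - 1))) = 0"
  proof -
    consider "k = 0" | "k = 1" | "m < k + (m - 1)" using assms(2) by linarith
    then show ?thesis using assms(1) phi_I by cases auto
  qed
  moreover have "m - 1 = 0" if "m - 1 = - k" using that assms(2) m_pos by linarith
  ultimately show ?thesis by (auto simp: bsum_ID)
qed

lemma bsum_D_I1:
  assumes "\<phi> (I m) = 0" "m < n"
  shows "bsum (D n) (I (-1)) \<phi> = 0"
proof -
  have "\<phi> (I (n - 1)) = 0" using assms phi_I by (cases "n - 1 = m") auto
  then show ?thesis using assms m_pos by (simp add: bsum_DI)
qed

lemma bsum_D_D:
  assumes "m \<le> n"
  shows "bsum (D n) (D (m - 1)) \<phi> = of_int (m - 1 - n) * \<phi> (D (n + m - 1))"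
  using assms m_pos by (auto simp: bsum_DD algebra_simps)

lemma bsum_D_I2:
  assumes "\<phi> (I m) = 0" "m + 1 < n"
  shows "bsum (D n) (I (-2)) \<phi> = 0"
proof -
  have "\<phi> (I (n - 2)) = 0" using assms phi_I by (cases "n - 2 = m") auto
  then show ?thesis using assms m_pos by (simp add: bsum_DI)
qed

text \<open>\<open>\<beta>\<close> and \<open>\<gamma>\<close> solve the equations imposed by \<open>d\<^sub>m\<^sub>+\<^sub>1\<close> and \<open>d\<^sub>m\<close>. For \<open>m = 1\<close>,
  \<open>[d\<^sub>1, I\<^sub>-\<^sub>2]\<close> leaves the subalgebra, so \<open>\<beta>\<close> must vanish there.\<close>

lemma not_simple_linear:
  assumes Im: "\<phi> (I m) = 0" and nz: "bsum (D m) (I (-1)) \<phi> \<noteq> 0" and "m \<noteq> 1 \<or> \<phi> (D (2 * m)) = 0"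
  shows "\<not> whittaker_simple m \<phi>"
proof -
  define e where "e = bsum (D m) (I (-1)) \<phi>"
  define \<beta> where "\<beta> = \<phi> (D (2 * m)) / e"
  define \<gamma> where "\<gamma> = (\<phi> (D (2 * m - 1)) - \<beta> * bsum (D m) (I (-2)) \<phi>) / e"
  define c where "c y = (if y = D (m - 1) then 1 else if y = I (-2) then \<beta> else \<gamma>)" for y
  have e: "e \<noteq> 0" using nz by (simp add: e_def)
  have \<beta>1: "\<beta> = 0" if "m = 1" using assms(3) that by (auto simp: \<beta>_def)
  show ?thesis
  proof (rule not_simple_if_linear_vector [of "{D (m - 1), I (-2), I (-1)}" "D (m - 1)" c])
    fix x y g assume "x \<in> bgen m" "y \<in> {D (m - 1), I (-2), I (-1)}" "c y \<noteq> 0" "brk x y g \<noteq> 0"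
    then show "g \<in> bgen m"
      using brk_in_bgen [of x y g] \<beta>1 by (cases "m = 1") (auto simp: c_def)
  next
    fix x assume x: "x \<in> bgen m"
    have "(\<Sum>y\<in>{D (m - 1), I (-2), I (-1)}. c y * bsum x y \<phi>) =
        bsum x (D (m - 1)) \<phi> + \<beta> * bsum x (I (-2)) \<phi> + \<gamma> * bsum x (I (-1)) \<phi>"
      by (simp add: c_def)
    also have "\<dots> = 0"
      using x
    proof (cases rule: bgen_cases)
      case (1 k)
      then show ?thesis using bsum_I_D [OF Im] by (simp add: bsum_I_neg)
    next
      case (2 n)
      consider "n = m" | "n = m + 1" | "m + 1 < n" using 2 by linarith
      then show ?thesis
      proof cases
        case 1
        have "bsum (D m) (D (m - 1)) \<phi> = - \<phi> (D (2 * m - 1))"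
          using bsum_D_D [of m] by simp
        then show ?thesis using 1 2 e by (simp add: \<gamma>_def flip: e_def)
      next
        case n: 2
        \<comment> \<open>For m \<noteq> 1 no central term enters: [d_m, I_{-1}] = -I_{m-1} and
          [d_{m+1}, I_{-2}] = -2 I_{m-1}.\<close>
        have "\<beta> * bsum (D (m + 1)) (I (-2)) \<phi> = 2 * e * \<beta>"
        proof (cases "m = 1")
          case False
          then have "e = - \<phi> (I (m - 1))" "bsum (D (m + 1)) (I (-2)) \<phi> = - 2 * \<phi> (I (m - 1))"
            using m_pos by (simp_all add: e_def bsum_DI)
          then show ?thesis by simp
        qed (simp add: \<beta>1)
        moreover have "bsum (D (m + 1)) (D (m - 1)) \<phi> = - 2 * \<phi> (D (2 * m))"
          using bsum_D_D [of "m + 1"] by simp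
        moreover have "bsum (D (m + 1)) (I (-1)) \<phi> = 0" by (rule bsum_D_I1 [OF Im]) simp
        ultimately show ?thesis using 2 n e by (simp add: \<beta>_def)
      next
        case 3
        have "\<phi> (D (n + m - 1)) = 0" by (rule phi_D) (use 3 in simp)
        then show ?thesis
          using 2 3 bsum_D_D [of n] bsum_D_I1 [OF Im, of n] bsum_D_I2 [OF Im, of n] by simp
      qed
    next
      case 3
      then show ?thesis by auto
    qed
    finally show "(\<Sum>y\<in>{D (m - 1), I (-2), I (-1)}. c y * bsum x y \<phi>) = 0" .
  qed (simp_all add: c_def D_in_bgen)
qed

text \<open>By the Leibniz rule two terms arise. [x, I_{-1}] involves only \<open>I\<close>s and
  central elements, which commute with I_{-1} modulo \<open>K\<close>, so each term gives
  \<phi>([x, I_{-1}]) I_{-1}.\<close>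

lemma act_square:
  assumes x: "x \<in> bgen m"
  shows "act x (mono [I (-1), I (-1)]) - scl (2 * bsum x (I (-1)) \<phi>) (mono [I (-1)]) \<in> K"
proof -
  let ?y = "I (-1)"
  note K_rules = T.subspace_add [OF Kid_subspace] T.subspace_diff [OF Kid_subspace]
  have inner: "mono [g, ?y] - scl (\<phi> g) (mono [?y]) \<in> K" if g: "brk x ?y g \<noteq> 0" for g
  proof -
    have gb: "g \<in> bgen m" by (rule brk_in_bgen(2) [OF x g refl])
    have "comm g ?y (\<lambda>h. mono [h]) \<in> K"
    proof (rule comm_in [OF Kid_subspace])
      fix h assume h: "brk g ?y h \<noteq> 0"
      have "g \<noteq> D n" for n
        using g by (cases x) (auto split: if_splits)
      then have "h = Z3" using h by (cases g) (auto split: if_splits)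
      then show "mono [h] \<in> K" using Z3_in [of "[]" "[]"] by simp
    qed
    from K_rules(1) [OF act_mono [OF gb, of ?y] this] show ?thesis by (simp add: act_def)
  qed
  have "comm x ?y (\<lambda>g. mono [g, ?y] - scl (\<phi> g) (mono [?y])) \<in> K"
    by (rule comm_in [OF Kid_subspace inner])
  then have "comm x ?y (\<lambda>g. mono [g, ?y]) - comm x ?y (\<lambda>g. scl (\<phi> g) (mono [?y])) \<in> K"
    by (simp only: comm_diff)
  moreover have "comm x ?y (\<lambda>g. scl (\<phi> g) (mono [?y])) = scl (bsum x ?y \<phi>) (mono [?y])"
    by (simp add: fun_eq_iff comm_apply pointwise bsum_mult_right)
  ultimately have 1: "comm x ?y (\<lambda>g. mono [g, ?y]) - scl (bsum x ?y \<phi>) (mono [?y]) \<in> K"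
    by (simp only:)
  have 2: "mono [x, ?y, ?y] - mono [?y, x, ?y] - comm x ?y (\<lambda>g. mono [g, ?y]) \<in> K"
    using swap_in [of "[]" x ?y "[?y]"] by simp
  have 3: "mono [?y, x, ?y] - scl (\<phi> x) (mono [?y, ?y]) - scl (bsum x ?y \<phi>) (mono [?y]) \<in> K"
    using Kid_left [OF act_mono_scalar [OF x, of ?y], of "[?y]"] brk_in_bgen(2) [OF x]
    by (simp add: act_def tmul_linear)
  have "act x (mono [?y, ?y]) - scl (2 * bsum x ?y \<phi>) (mono [?y]) =
     (mono [x, ?y, ?y] - mono [?y, x, ?y] - comm x ?y (\<lambda>g. mono [g, ?y]))
     + (mono [?y, x, ?y] - scl (\<phi> x) (mono [?y, ?y]) - scl (bsum x ?y \<phi>) (mono [?y]))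
     + (comm x ?y (\<lambda>g. mono [g, ?y]) - scl (bsum x ?y \<phi>) (mono [?y]))"
    by (simp add: act_def fun_eq_iff pointwise tmul_mono_mono algebra_simps)
  also have "\<dots> \<in> K" by (intro K_rules(1) 1 2 3)
  finally show ?thesis .
qed

lemma not_simple_quadratic:
  assumes Im: "\<phi> (I m) = 0" and m1: "m = 1" and nz: "bsum (D m) (I (-1)) \<phi> \<noteq> 0" and d2: "\<phi> (D 2) \<noteq> 0"
  shows "\<not> whittaker_simple m \<phi>"
proof (rule not_simple_if_whittaker_vector)
  \<comment> \<open>For c0 d_0 + c2 I_{-2} + c1 I_{-1} + c I_{-1}^2, the element d_1 demands c2 = c
    a (coefficient of I_{-1}) and c1 a = c0 \<phi>(d_1) (constant part), and d_2 demands c2 b = 2 c0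
    \<phi>(d_2). Choosing c = 2 \<phi>(d_2) avoids division. As \<open>b\<close> may be 0, d_0 may
    drop out, but the leading coefficient \<open>c\<close> is nonzero.\<close>
  define a where "a = bsum (D 1) (I (-1)) \<phi>"
  define b where "b = bsum (D 2) (I (-2)) \<phi>"
  define c0 where "c0 = a * b"
  define c2 where "c2 = 2 * \<phi> (D 2) * a"
  define c1 where "c1 = b * \<phi> (D 1)"
  define c where "c = 2 * \<phi> (D 2)"
  define U where "U = scl c0 (mono [D 0]) + scl c2 (mono [I (-2)]) + scl c1 (mono [I (-1)])
    + scl c (mono [I (-1), I (-1)])"
  have U: "U t = (if t = [D 0] then c0 else 0) + (if t = [I (-2)] then c2 else 0)
      + (if t = [I (-1)] then c1 else 0) + (if t = [I (-1), I (-1)] then c else 0)" for t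
    by (simp add: U_def pointwise mono_apply)
  note K_rules = T.subspace_add [OF Kid_subspace] T.subspace_scale [OF Kid_subspace]
  show "U \<in> fsupp"
    unfolding U_def by (intro T.subspace_add T.subspace_scale fsupp_subspace mono_fsupp)
  show "U (replicate 2 (I (-1))) \<noteq> 0" using d2 by (simp add: U c_def numeral_2_eq_2)
  show "I (-1) \<notin> bgen m" by (simp add: I_in_bgen)
  show "0 < (2::nat)" by simp
  show "length t \<le> 2 \<and> (length t = 2 \<longrightarrow> t = replicate 2 (I (-1)) \<or> count (mset t) (I (-1)) < 2)"
    if "U t \<noteq> 0" for t
    using that by (auto simp: U numeral_2_eq_2 split: if_splits)
  fix x assume x: "x \<in> bgen m"
  have act_U: "act x U = scl c0 (act x (mono [D 0])) + scl c2 (act x (mono [I (-2)])) + scl c1 (act x (mono [I (-1)]))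
    + scl c (act x (mono [I (-1), I (-1)]))"
    by (simp add: U_def act_def tmul_linear fun_eq_iff pointwise algebra_simps)
  have A0: "act x (mono [D 0]) - scl (bsum x (D 0) \<phi>) (mono []) \<in> K"
    by (rule act_mono_scalar [OF x], rule brk_in_bgen(1) [OF x], assumption) (simp add: m1)
  have A1: "act x (mono [I (-1)]) - scl (bsum x (I (-1)) \<phi>) (mono []) \<in> K"
    by (rule act_mono_scalar [OF x], rule brk_in_bgen(2) [OF x], assumption) simp
  note A11 = act_square [OF x]
  have "act x U \<in> K"
  proof (cases "x = D 1")
    case True
    have "act x (mono [I (-2)]) - scl (- 2) (mono [I (-1)]) \<in> K"
      using act_mono [OF x, of "I (-2)"] True by (simp add: comm_DI)
    then have "scl c0 (act x (mono [D 0]) - scl (bsum x (D 0) \<phi>) (mono []))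
      + scl c2 (act x (mono [I (-2)]) - scl (- 2) (mono [I (-1)]))
      + scl c1 (act x (mono [I (-1)]) - scl (bsum x (I (-1)) \<phi>) (mono []))
      + scl c (act x (mono [I (-1), I (-1)]) - scl (2 * bsum x (I (-1)) \<phi>) (mono [I (-1)])) \<in> K"
      by (intro K_rules A0 A1 A11)
    moreover have "bsum x (D 0) \<phi> = - \<phi> (D 1)" "bsum x (I (-1)) \<phi> = a"
      using True by (simp add: bsum_DD) (simp add: a_def True)
    ultimately show ?thesis
      unfolding act_U
      by (simp add: c0_def c1_def c2_def c_def fun_eq_iff pointwise algebra_simps)
  next
    case False
    have A2: "act x (mono [I (-2)]) - scl (bsum x (I (-2)) \<phi>) (mono []) \<in> K"
      by (rule act_mono_scalar [OF x], rule brk_in_bgen(3) [OF x], assumption) (simp_all add: False)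
    have z1: "bsum x (I (-1)) \<phi> = 0"
      using x by (cases rule: bgen_cases) (use False bsum_D_I1 [OF Im] m1 in \<open>auto simp: bsum_I_neg\<close>)
    have z: "c0 * bsum x (D 0) \<phi> + c2 * bsum x (I (-2)) \<phi> = 0"
      using x
    proof (cases rule: bgen_cases)
      case (1 k)
      then show ?thesis using bsum_I_D [OF Im, of k] m1 by (simp add: bsum_I_neg)
    next
      case (2 n)
      consider "n = 2" | "2 < n" using 2 False m1 by fastforce
      then show ?thesis
      proof cases
        case 1
        have "bsum (D 2) (D 0) \<phi> = - 2 * \<phi> (D 2)" using bsum_D_D [of 2] m1 by simp
        then show ?thesis using 1 2 by (simp add: c0_def c2_def flip: b_def)
      next
        case 3: 2
        have "\<phi> (D n) = 0" by (rule phi_D) (use 3 m1 in simp)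
        then have "bsum (D n) (D 0) \<phi> = 0" using bsum_D_D [of n] m1 2 by simp
        then show ?thesis using 2 3 bsum_D_I2 [OF Im, of n] m1 by simp
      qed
    next
      case 3
      then show ?thesis by auto
    qed
    have "scl c0 (act x (mono [D 0]) - scl (bsum x (D 0) \<phi>) (mono []))
      + scl c2 (act x (mono [I (-2)]) - scl (bsum x (I (-2)) \<phi>) (mono []))
      + scl c1 (act x (mono [I (-1)]) - scl (bsum x (I (-1)) \<phi>) (mono []))
      + scl c (act x (mono [I (-1), I (-1)]) - scl (2 * bsum x (I (-1)) \<phi>) (mono [I (-1)])) \<in> K"
      by (intro K_rules A0 A1 A2 A11)
    also have "scl c0 (act x (mono [D 0]) - scl (bsum x (D 0) \<phi>) (mono []))
      + scl c2 (act x (mono [I (-2)]) - scl (bsum x (I (-2)) \<phi>) (mono []))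
      + scl c1 (act x (mono [I (-1)]) - scl (bsum x (I (-1)) \<phi>) (mono []))
      + scl c (act x (mono [I (-1), I (-1)]) - scl (2 * bsum x (I (-1)) \<phi>) (mono [I (-1)]))
      = act x U - scl (c0 * bsum x (D 0) \<phi> + c2 * bsum x (I (-2)) \<phi>) (mono [])"
      unfolding act_U z1 by (simp add: fun_eq_iff pointwise algebra_simps)
    finally show ?thesis by (simp add: z)
  qed
  then show "tmul (mono [x]) U - scl (\<phi> x) U \<in> K" by (simp add: act_def)
qed

text \<open>If \<phi>([d_m, I_{-1}]) = 0, then I_{-1} alone is a Whittaker vector, d_m being the
  only test element with a possibly nonzero value. Otherwise the linear equations are solvable
  unless m = 1 and \<phi>(d_2) \<noteq> 0, which is the quadratic case.\<close>

lemma not_simple_if: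
  assumes Im: "\<phi> (I m) = 0"
  shows "\<not> whittaker_simple m \<phi>"
proof (cases "bsum (D m) (I (-1)) \<phi> = 0")
  case True
  have "bsum x (I (-1)) \<phi> = 0" if "x \<in> bgen m" for x
    using that
  proof (cases rule: bgen_cases)
    case (2 n)
    then show ?thesis using True bsum_D_I1 [OF Im, of n] by (cases "n = m") auto
  qed (auto simp: bsum_I_neg)
  then show ?thesis
    using not_simple_if_linear_vector [of "{I (-1)}" "I (-1)" "\<lambda>_. 1"] brk_in_bgen(2) by (simp add: I_in_bgen)
next
  case False
  then show ?thesis
    using not_simple_linear [OF Im] not_simple_quadratic [OF Im] by fastforce
qed

end

theorem theorem14:
  fixes m :: int and \<phi> :: "gen \<Rightarrow> complex"
  assumes "1 \<le> m"
    and "lie_hom_b m \<phi>"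
    and "\<phi> Z3 = 0"
  shows "whittaker_simple m \<phi> \<longleftrightarrow> \<phi> (I m) \<noteq> 0"
proof -
  interpret whittaker_level_zero m \<phi> by unfold_locales (use assms in auto)
  show ?thesis using simple_if not_simple_if by blast
qed

end
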